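(* Let $n \ge 4$ be an integer and let $\mathcal{C}_n(\pi) = (0,\pi)^n \subset \mathbb{R}^n$ be the open hypercube. Then the Extended Courant Property for $\mathcal{C}_n(\pi)$ with the Neumann boundary condition on $\partial \mathcal{C}_n(\pi)$ is false; that is, there exist an integer $m \ge 1$ and a linear combination $v$ of Neumann eigenfunctions of $-\Delta$ in $\mathcal{C}_n(\pi)$ associated with eigenvalues less than or equal to $\lambda_m$ such that $\beta_0(v) > \kappa(\lambda_m)$.
   Context: Let $\Omega$ be a bounded domain, with a self-adjoint realization of $-\Delta$ given by a homogeneous boundary condition $\mathfrak{b}$ (here $\mathfrak{b}=\mathfrak{n}$, the Neumann condition $\frac{\partial u}{\partial \nu}|_{\partial\Omega}=0$). Its eigenvalues are listed in nondecreasing order, counted with multiplicity and starting with index $1$: $\lambda_1 < \lambda_2 \le \lambda_3 \le \cdots$. For an eigenvalue $\lambda$, set $\kappa(\lambda) = \min\{k \mid \lambda_k = \lambda\}$. For $\lambda \ge 0$, let $\mathcal{L}(\Omega,\mathfrak{b},\lambda)$ be the real vector space of linear combinations of real eigenfunctions associated with eigenvalues $\le \lambda$. For a real continuous function $v$ on $\Omega$, the nodal set is $\mathcal{Z}(v) = \overline{\{x \in \Omega \mid v(x) = 0\}}$, and $\beta_0(v)$ denotes the number of connected components of $\Omega \setminus \mathcal{Z}(v)$ (nodal domains). The Extended Courant Property $\mathrm{ECP}(\Omega,\mathfrak{b})$ is the assertion: for every $m \ge 1$ and every $v \in \mathcal{L}(\Omega,\mathfrak{b},\lambda_m)$, one has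 $\beta_0(v) \le \kappa(\lambda_m) \le m$. *)

theory Defs
  imports "HOL-Analysis.Analysis" "HOL-Library.Function_Algebras" "HOL-Library.Extended_Nat"
begin

instantiation "fun" :: (type, real_vector) real_vector
begin

definition scaleR_fun :: "real \<Rightarrow> ('a \<Rightarrow> 'b) \<Rightarrow> 'a \<Rightarrow> 'b" where
  "scaleR_fun c f = (\<lambda>x. c *\<^sub>R f x)"

instance
  by standard (auto simp: scaleR_fun_def plus_fun_def fun_eq_iff scaleR_add_left scaleR_add_right)

end

definition partial_deriv :: "'a \<Rightarrow> ('a::euclidean_space \<Rightarrow> real) \<Rightarrow> 'a \<Rightarrow> real" where
  "partial_deriv i f = (\<lambda>x. frechet_derivative f (at x) i)"

text \<open>\<open>C\<close>-infinity on the whole space: everywhere differentiable, with all first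
  partial derivatives again of this kind (greatest such class).\<close>

coinductive smooth :: "('a::euclidean_space \<Rightarrow> real) \<Rightarrow> bool" where
  "(\<And>x. f differentiable (at x)) \<Longrightarrow> (\<And>i. i \<in> Basis \<Longrightarrow> smooth (partial_deriv i f)) \<Longrightarrow> smooth f"

definition test_function :: "'a::euclidean_space set \<Rightarrow> ('a \<Rightarrow> real) \<Rightarrow> bool" where
  "test_function \<Omega> \<phi> \<longleftrightarrow>
     smooth \<phi> \<and> compact (closure {x. \<phi> x \<noteq> 0}) \<and> closure {x. \<phi> x \<noteq> 0} \<subseteq> \<Omega>"

definition square_integrable_on :: "'a::euclidean_space set \<Rightarrow> ('a \<Rightarrow> real) \<Rightarrow> bool" where
  "square_integrable_on \<Omega> u \<longleftrightarrow>
     set_borel_measurable lebesgue \<Omega> u \<and> set_integrable lebesgue \<Omega> (\<lambda>x. (u x)\<^sup>2)"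

text \<open>\<open>u\<close> belongs to the Sobolev space \<open>H\<^sup>1(\<Omega>)\<close> and \<open>g\<close> is its weak gradient.\<close>

definition H1_with_gradient ::
    "'a::euclidean_space set \<Rightarrow> ('a \<Rightarrow> real) \<Rightarrow> ('a \<Rightarrow> 'a) \<Rightarrow> bool" where
  "H1_with_gradient \<Omega> u g \<longleftrightarrow>
     square_integrable_on \<Omega> u \<and>
     (\<forall>i\<in>Basis. square_integrable_on \<Omega> (\<lambda>x. g x \<bullet> i) \<and>
        (\<forall>\<phi>. test_function \<Omega> \<phi> \<longrightarrow>
           (LINT x:\<Omega>|lebesgue. u x * partial_deriv i \<phi> x)
             = - (LINT x:\<Omega>|lebesgue. (g x \<bullet> i) * \<phi> x)))"

text \<open>The self-adjoint Neumann realization of \<open>-\<Delta>\<close> is the operator associated with the form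
  \<open>\<integral> \<nabla>u \<bullet> \<nabla>w\<close> on \<open>H\<^sup>1(\<Omega>)\<close>; its eigenvalue equation is the one below, the Neumann
  boundary condition being encoded by letting \<open>w\<close> range over all of \<open>H\<^sup>1(\<Omega>)\<close>. Eigenfunctions
  are elements of \<open>L\<^sup>2(\<Omega>)\<close>, and by interior regularity each of them has exactly one
  representative that is continuous on the open set \<open>\<Omega>\<close>. We use that representative, extended
  by \<open>0\<close>, so that equality of functions on the whole space is equality in \<open>L\<^sup>2(\<Omega>)\<close> and linear
  independence and dimension have their usual meaning.\<close>

definition neumann_eigenspace :: "'a::euclidean_space set \<Rightarrow> real \<Rightarrow> ('a \<Rightarrow> real) set" where
  "neumann_eigenspace \<Omega> \<mu> =
     {u. continuous_on \<Omega> u \<and> (\<forall>x. x \<notin> \<Omega> \<longrightarrow> u x = 0) \<and>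
         (\<exists>g. H1_with_gradient \<Omega> u g \<and>
            (\<forall>w h. H1_with_gradient \<Omega> w h \<longrightarrow>
               (LINT x:\<Omega>|lebesgue. g x \<bullet> h x) = \<mu> * (LINT x:\<Omega>|lebesgue. u x * w x)))}"

definition neumann_eigenfunction :: "'a::euclidean_space set \<Rightarrow> real \<Rightarrow> ('a \<Rightarrow> real) \<Rightarrow> bool" where
  "neumann_eigenfunction \<Omega> \<mu> u \<longleftrightarrow> u \<in> neumann_eigenspace \<Omega> \<mu> \<and> u \<noteq> 0"

text \<open>Indices start at 1. Each real \<open>\<mu>\<close> is listed as often as the dimension of its eigenspace;
  in particular the listed numbers are exactly the eigenvalues.\<close>

definition neumann_listing :: "'a::euclidean_space set \<Rightarrow> (nat \<Rightarrow> real) \<Rightarrow> bool" where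
  "neumann_listing \<Omega> \<Lambda> \<longleftrightarrow>
     mono_on {1..} \<Lambda> \<and>
     (\<forall>\<mu>. \<exists>B b. independent B \<and> span B = neumann_eigenspace \<Omega> \<mu> \<and>
            bij_betw b {k. 1 \<le> k \<and> \<Lambda> k = \<mu>} B)"

text \<open>The values at indices \<open>k \<ge> 1\<close> of a listing are uniquely determined by \<open>\<Omega>\<close>; the value at
  \<open>k = 0\<close> is arbitrary and never used.\<close>

definition neumann_eigenvalue :: "'a::euclidean_space set \<Rightarrow> nat \<Rightarrow> real" where
  "neumann_eigenvalue \<Omega> = (SOME \<Lambda>. neumann_listing \<Omega> \<Lambda>)"

definition neumann_kappa :: "'a::euclidean_space set \<Rightarrow> real \<Rightarrow> nat" where
  "neumann_kappa \<Omega> \<mu> = (LEAST k. 1 \<le> k \<and> neumann_eigenvalue \<Omega> k = \<mu>)"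

definition neumann_combinations :: "'a::euclidean_space set \<Rightarrow> real \<Rightarrow> ('a \<Rightarrow> real) set" where
  "neumann_combinations \<Omega> \<mu> = span {u. \<exists>\<nu>\<le>\<mu>. neumann_eigenfunction \<Omega> \<nu> u}"

definition nodal_set :: "'a::euclidean_space set \<Rightarrow> ('a \<Rightarrow> real) \<Rightarrow> 'a set" where
  "nodal_set \<Omega> v = closure {x \<in> \<Omega>. v x = 0}"

text \<open>Extended-valued, since \<open>card\<close> is 0 on infinite sets.\<close>

definition nodal_count :: "'a::euclidean_space set \<Rightarrow> ('a \<Rightarrow> real) \<Rightarrow> enat" where
  "nodal_count \<Omega> v =
     (let D = components (\<Omega> - nodal_set \<Omega> v) in if finite D then enat (card D) else \<infinity>)"

definition ECP_neumann :: "'a::euclidean_space set \<Rightarrow> bool" where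
  "ECP_neumann \<Omega> \<longleftrightarrow>
     (\<forall>m\<ge>1. \<forall>v \<in> neumann_combinations \<Omega> (neumann_eigenvalue \<Omega> m).
        nodal_count \<Omega> v \<le> enat (neumann_kappa \<Omega> (neumann_eigenvalue \<Omega> m)) \<and>
        neumann_kappa \<Omega> (neumann_eigenvalue \<Omega> m) \<le> m)"

definition hypercube :: "real \<Rightarrow> (real ^ 'n) set" where
  "hypercube a = {x. \<forall>i. 0 < x $ i \<and> x $ i < a}"

end

theory Submission
  imports Defs
begin

text \<open>
  The counterexample lives at the eigenvalue 4. Write \<open>\<Omega> = (0,\<pi>)\<^sup>n\<close>. The function
  \<open>v(x) = (\<Sum>i. cos (2 x\<^sub>i)) - (n - 1)\<close> combines eigenfunctions for the eigenvalues 4 and 0. It is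
  positive near each of the \<open>2\<^sup>n\<close> corners of the cube, while on every hyperplane \<open>x\<^sub>i = \<pi>/2\<close> one of the
  cosines equals \<open>-1\<close>, so that \<open>v \<le> -1\<close> there. These hyperplanes separate the corners from each
  other; hence there are at least \<open>2\<^sup>n\<close> positive nodal domains, and at least one negative one
  (\<open>nodal_count_corner_eigensum\<close>). On the other hand \<open>\<kappa>(4) - 1\<close> is the number of eigenvalues below
  4, which is the number of \<open>k \<in> \<nat>\<^sup>n\<close> with \<open>\<bar>k\<bar>\<^sup>2 < 4\<close>. Such a \<open>k\<close> is the indicator of a set of at
  most three coordinates; for \<open>n \<ge> 4\<close> the full set is not among them, so \<open>\<kappa>(4) - 1 \<le> 2\<^sup>n - 1\<close>
  (\<open>neumann_kappa_4_le\<close>).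

  The count of eigenvalues requires the complete Neumann spectrum of the cube in the variational
  formulation: the eigenspace for \<open>\<mu>\<close> is spanned by the products \<open>c\<^sub>k(x) = \<Prod>i. cos (k\<^sub>i x\<^sub>i)\<close>
  with \<open>\<bar>k\<bar>\<^sup>2 = \<mu>\<close> (\<open>neumann_eigenspace_eq_span\<close>). Everything rests on one Green formula, valid
  for each coordinate separately and for all \<open>w \<in> H\<^sup>1(\<Omega>)\<close> with weak gradient \<open>h\<close>:
  the integral of \<open>(\<partial>\<^sub>i c\<^sub>k) h\<^sub>i\<close> equals \<open>k\<^sub>i\<^sup>2\<close> times the integral of \<open>c\<^sub>k w\<close>
  (\<open>Green_sine_cosine_product\<close>). Summing over \<open>i\<close> shows that \<open>c\<^sub>k\<close> is an eigenfunction, and that an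
  eigenfunction for \<open>\<mu>\<close> is orthogonal to \<open>c\<^sub>k\<close> unless \<open>\<mu> = \<bar>k\<bar>\<^sup>2\<close>. Applying it to \<open>w = c\<^sub>l\<close> makes
  distinct products orthogonal without computing a single integral. Finally, the \<open>c\<^sub>k\<close> span an algebra
  that separates points, so the Stone--Weierstrass theorem makes them complete: a continuous
  square integrable function orthogonal to all of them vanishes (\<open>cosine_product_complete\<close>).

  The Green formula itself is the definition of the weak gradient, applied to test functions that
  approximate \<open>sin (k\<^sub>i x\<^sub>i) \<Prod>j\<noteq>i. cos (k\<^sub>j x\<^sub>j)\<close>. They are obtained by multiplying with smooth cutoffs
  in each coordinate. In the direction of the derivative, the large derivative of the cutoff near the faces
  \<open>x\<^sub>i = 0\<close> and \<open>x\<^sub>i = \<pi>\<close> is compensated by the zero of the sine, and this is where the Neumann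
  condition enters.
\<close>

section \<open>Smooth functions of one real variable\<close>
primrec times_differentiable :: "nat \<Rightarrow> (real \<Rightarrow> real) \<Rightarrow> bool" where
  "times_differentiable 0 f \<longleftrightarrow> True"
| "times_differentiable (Suc m) f \<longleftrightarrow>
     (\<exists>f'. (\<forall>t. (f has_real_derivative f' t) (at t)) \<and> times_differentiable m f')"

lemma times_differentiable_weaken:
  "times_differentiable (Suc m) f \<Longrightarrow> times_differentiable m f"
proof (induction m arbitrary: f)
  case (Suc m)
  then obtain f' where "\<forall>t. (f has_real_derivative f' t) (at t)" "times_differentiable (Suc m) f'"
    by (auto simp del: times_differentiable.simps simp: times_differentiable.simps(2)[of "Suc m"])
  with Suc.IH show ?case
    by auto
qed simp

lemma times_differentiable_add:
  "times_differentiable m f \<Longrightarrow> times_differentiable m g \<Longrightarrow> times_differentiable m (\<lambda>t. f t + g t)"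
proof (induction m arbitrary: f g)
  case (Suc m)
  then obtain f' g' where
    "\<forall>t. (f has_real_derivative f' t) (at t)" "times_differentiable m f'"
    "\<forall>t. (g has_real_derivative g' t) (at t)" "times_differentiable m g'"
    by auto
  with Suc.IH[of f' g'] show ?case
    by (auto intro!: exI[of _ "\<lambda>t. f' t + g' t"] derivative_intros)
qed simp

lemma times_differentiable_mult:
  "times_differentiable m f \<Longrightarrow> times_differentiable m g \<Longrightarrow> times_differentiable m (\<lambda>t. f t * g t)"
proof (induction m arbitrary: f g)
  case (Suc m)
  then obtain f' g' where
    D: "\<forall>t. (f has_real_derivative f' t) (at t)" "\<forall>t. (g has_real_derivative g' t) (at t)"
    and S: "times_differentiable m f'" "times_differentiable m g'"
    by auto
  have "times_differentiable m f" "times_differentiable m g"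
    using Suc.prems times_differentiable_weaken by blast+
  then have "times_differentiable m (\<lambda>t. f' t * g t + g' t * f t)"
    using S Suc.IH by (intro times_differentiable_add) auto
  then show ?case
    using D by (auto intro!: exI[of _ "\<lambda>t. f' t * g t + g' t * f t"] derivative_eq_intros)
qed simp

lemma times_differentiable_const: "times_differentiable m (\<lambda>t. c)"
  by (induction m arbitrary: c) (auto intro!: exI[of _ "\<lambda>t. 0"])

lemma times_differentiable_ident: "times_differentiable m (\<lambda>t. t)"
  by (cases m) (auto intro!: exI[of _ "\<lambda>t. 1"] times_differentiable_const)

lemma times_differentiable_compose:
  "times_differentiable m f \<Longrightarrow> times_differentiable m g \<Longrightarrow> times_differentiable m (\<lambda>t. f (g t))"
proof (induction m arbitrary: f)
  case (Suc m)
  then obtain f' g' where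
    D: "\<forall>t. (f has_real_derivative f' t) (at t)" "\<forall>t. (g has_real_derivative g' t) (at t)"
    and S: "times_differentiable m f'" "times_differentiable m g'"
    by auto
  have "times_differentiable m (\<lambda>t. f' (g t) * g' t)"
    using Suc.IH[OF S(1)] times_differentiable_weaken[OF Suc.prems(2)] S(2)
    by (intro times_differentiable_mult) auto
  moreover have "((\<lambda>t. f (g t)) has_real_derivative f' (g t) * g' t) (at t)" for t
    using DERIV_chain2[of f "f' (g t)" g t "g' t" UNIV] D by auto
  ultimately show ?case
    unfolding times_differentiable.simps by (intro exI[of _ "\<lambda>t. f' (g t) * g' t"]) blast
qed simp

lemma times_differentiable_sin_cos:
  "times_differentiable m sin \<and> times_differentiable m cos"
proof (induction m)
  case (Suc m)
  have "times_differentiable m (\<lambda>t. - 1 * sin t)"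
    using Suc by (intro times_differentiable_mult times_differentiable_const) auto
  with Suc show ?case
    by (auto intro: exI[of _ cos] exI[of _ "\<lambda>t. - sin t"] intro!: derivative_eq_intros)
qed simp

text \<open>
  The functions \<open>s\<^sup>-\<^sup>j exp (-1/s)\<close>, extended by 0 to \<open>s \<le> 0\<close>. As a family in \<open>j\<close> they are closed
  under differentiation up to linear combinations, which gives the smoothness of all of them at once.
\<close>
definition flat_power :: "nat \<Rightarrow> real \<Rightarrow> real" where
  "flat_power j s = (if s > 0 then inverse s ^ j * exp (- inverse s) else 0)"

lemma power_div_fact_le_exp:
  fixes y :: real assumes "y \<ge> 0" shows "y ^ m / fact m \<le> exp y"
proof -
  have "(\<Sum>i\<in>{m}. y ^ i /\<^sub>R fact i) \<le> (\<Sum>i. y ^ i /\<^sub>R fact i)"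
    using assms exp_converges[of y] by (intro sum_le_suminf) (auto simp: sums_iff)
  then show ?thesis
    by (simp add: exp_def divide_inverse mult.commute)
qed

lemma flat_power_nonneg: "0 \<le> flat_power j s"
  by (simp add: flat_power_def)

text \<open>
  Flatness of every order at 0, from \<open>y ^ (j + i) \<le> fact (j + i) * exp y\<close> at \<open>y = 1/s\<close>. The case
  \<open>i = 2\<close> gives the derivative at 0, the case \<open>i = 0\<close> a uniform bound.
\<close>
lemma flat_power_le: "flat_power j s \<le> fact (j + i) * \<bar>s\<bar> ^ i"
proof (cases "s > 0")
  case True
  have "inverse s ^ (j + i) / fact (j + i) \<le> exp (inverse s)"
    using True by (intro power_div_fact_le_exp) auto
  then have "inverse s ^ (j + i) \<le> fact (j + i) * exp (inverse s)"
    by (simp add: divide_le_eq mult.commute)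
  then have "inverse s ^ (j + i) * exp (- inverse s) \<le> fact (j + i) * exp (inverse s) * exp (- inverse s)"
    by (intro mult_right_mono) auto
  then have "inverse s ^ (j + i) * exp (- inverse s) \<le> fact (j + i)"
    by (simp add: mult.assoc exp_minus)
  then have "(inverse s ^ (j + i) * exp (- inverse s)) * s ^ i \<le> fact (j + i) * s ^ i"
    using True by (intro mult_right_mono) auto
  moreover have "(inverse s ^ (j + i) * exp (- inverse s)) * s ^ i = flat_power j s"
    using True by (simp add: flat_power_def power_add field_simps)
  ultimately show ?thesis
    using True by simp
qed (simp add: flat_power_def)

lemma flat_power_has_derivative:
  "(flat_power j has_real_derivative flat_power (j + 2) s - real j * flat_power (j + 1) s) (at s)"
proof -
  consider "s > 0" | "s < 0" | "s = 0" by linarith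
  then show ?thesis
  proof cases
    case 1
    have pe: "s * s ^ (n - Suc 0) = s ^ n" if "n \<noteq> 0" for n
      using that by (cases n) auto
    have "((\<lambda>s. inverse s ^ j * exp (- inverse s)) has_real_derivative
        flat_power (j + 2) s - real j * flat_power (j + 1) s) (at s)"
      using 1 by (cases j; (auto intro!: derivative_eq_intros simp: flat_power_def field_simps; metis pe neq0_conv))
    then show ?thesis
      by (rule has_field_derivative_transform_within_open[of _ _ _ "{0<..}"])
        (use 1 in \<open>auto simp: flat_power_def\<close>)
  next
    case 2
    have "((\<lambda>s. 0) has_real_derivative flat_power (j + 2) s - real j * flat_power (j + 1) s) (at s)"
      using 2 by (simp add: flat_power_def)
    then show ?thesis
      by (rule has_field_derivative_transform_within_open[of _ _ _ "{..<0}"])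
        (use 2 in \<open>auto simp: flat_power_def\<close>)
  next
    case 3
    have "((\<lambda>h. flat_power j h / h) \<longlongrightarrow> 0) (at 0)"
    proof (rule Lim_null_comparison)
      have "norm (flat_power j h / h) \<le> fact (j + 2) * \<bar>h\<bar>" if "h \<noteq> 0" for h
        using flat_power_le[of j h 2] flat_power_nonneg[of j h] that
        by (simp add: divide_le_eq power2_eq_square mult.assoc)
      then show "\<forall>\<^sub>F h in at 0. norm (flat_power j h / h) \<le> fact (j + 2) * \<bar>h\<bar>"
        by (auto simp: eventually_at intro: exI[of _ 1])
      show "((\<lambda>h. fact (j + 2) * \<bar>h\<bar>) \<longlongrightarrow> 0) (at (0::real))"
        by (auto intro!: tendsto_eq_intros)
    qed
    then show ?thesis
      using 3 by (simp add: DERIV_def flat_power_def)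
  qed
qed

lemma times_differentiable_flat_power: "times_differentiable m (flat_power j)"
proof (induction m arbitrary: j)
  case (Suc m)
  have "times_differentiable m (\<lambda>s. flat_power (j + 2) s + (- real j) * flat_power (j + 1) s)"
    using Suc by (intro times_differentiable_add times_differentiable_mult
        times_differentiable_const) auto
  then show ?case
    using flat_power_has_derivative by (auto intro!: exI)
qed simp

definition smooth_real :: "(real \<Rightarrow> real) \<Rightarrow> bool" where
  "smooth_real f \<longleftrightarrow> (\<forall>m. times_differentiable m f)"

lemma smooth_real_derivative:
  assumes "smooth_real f"
  shows "(f has_real_derivative deriv f t) (at t)" "smooth_real (deriv f)"
proof -
  have D: "\<exists>f'. (\<forall>t. (f has_real_derivative f' t) (at t)) \<and> times_differentiable m f'" for m
    using assms unfolding smooth_real_def by (metis times_differentiable.simps(2))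
  then show 1: "(f has_real_derivative deriv f t) (at t)" for t
    using DERIV_imp_deriv by metis
  show "smooth_real (deriv f)"
    unfolding smooth_real_def
  proof
    fix m
    obtain f' where f': "\<forall>t. (f has_real_derivative f' t) (at t)" "times_differentiable m f'"
      using D by blast
    then have "deriv f = f'"
      using DERIV_imp_deriv by blast
    with f' show "times_differentiable m (deriv f)" by simp
  qed
qed

section \<open>Cutoffs on the interval from 0 to pi\<close>

text \<open>
  The quadratic \<open>m t (\<pi> - t) - 1\<close> is positive only on a compact part of \<open>(0,\<pi>)\<close> and tends to infinity
  with \<open>m\<close> at each inner point, where \<open>exp (-1/s)\<close> tends to 1.
\<close>
definition cutoff :: "nat \<Rightarrow> real \<Rightarrow> real" where
  "cutoff m t = flat_power 0 (real m * (t * (pi - t)) - 1)"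

text \<open>The derivative of \<open>cutoff m\<close>, since \<open>exp (-1/s)\<close> has derivative \<open>s\<^sup>-\<^sup>2 exp (-1/s)\<close>.\<close>
definition cutoff' :: "nat \<Rightarrow> real \<Rightarrow> real" where
  "cutoff' m t = flat_power 2 (real m * (t * (pi - t)) - 1) * (real m * (pi - 2 * t))"

lemma smooth_real_mult: "smooth_real f \<Longrightarrow> smooth_real g \<Longrightarrow> smooth_real (\<lambda>t. f t * g t)"
  by (simp add: smooth_real_def times_differentiable_mult)

lemma smooth_real_sin: "smooth_real (\<lambda>t. sin (c * t))"
  and smooth_real_cos: "smooth_real (\<lambda>t. cos (c * t))"
  unfolding smooth_real_def
  using times_differentiable_sin_cos times_differentiable_compose[of _ _ "\<lambda>t. c * t"]
    times_differentiable_mult[OF times_differentiable_const times_differentiable_ident] by blast+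

lemma smooth_real_cutoff: "smooth_real (cutoff m)"
proof -
  have "times_differentiable j (\<lambda>t. real m * (t * (pi + (- 1) * t)) + (- 1))" for j
    by (intro times_differentiable_add times_differentiable_mult times_differentiable_const
        times_differentiable_ident)
  then show ?thesis
    using times_differentiable_compose[OF times_differentiable_flat_power]
    by (auto simp: smooth_real_def cutoff_def[abs_def])
qed

lemma cutoff_has_derivative: "(cutoff m has_real_derivative cutoff' m t) (at t)"
proof -
  have "((\<lambda>t. real m * (t * (pi - t)) - 1) has_real_derivative real m * (pi - 2 * t)) (at t)"
    by (auto intro!: derivative_eq_intros simp: algebra_simps)
  from DERIV_chain2[OF flat_power_has_derivative this, of 0] show ?thesis
    by (simp add: cutoff_def[abs_def] cutoff'_def numeral_2_eq_2)
qed

lemma cutoff_le_1: "0 \<le> cutoff m t" "cutoff m t \<le> 1"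
  by (auto simp: cutoff_def flat_power_def)

lemma cutoff_tendsto:
  assumes "0 < t" "t < pi" shows "(\<lambda>m. cutoff m t) \<longlonglongrightarrow> 1"
proof -
  have p: "t * (pi - t) > 0" using assms by simp
  then have 1: "filterlim (\<lambda>m. real m * (t * (pi - t)) - 1) at_top sequentially"
    by real_asymp
  then have "\<forall>\<^sub>F m in sequentially. real m * (t * (pi - t)) - 1 > 0"
    unfolding filterlim_at_top_dense by blast
  then have "\<forall>\<^sub>F m in sequentially. exp (- inverse (real m * (t * (pi - t)) - 1)) = cutoff m t"
    by eventually_elim (simp add: cutoff_def flat_power_def)
  moreover have "(\<lambda>m. exp (- inverse (real m * (t * (pi - t)) - 1))) \<longlonglongrightarrow> exp (- 0)"
    by (intro tendsto_intros tendsto_inverse_0_at_top 1)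
  ultimately show ?thesis
    using Lim_transform_eventually by fastforce
qed

text \<open>The sine vanishes at both ends of the interval, and one of \<open>t\<close> and \<open>\<pi> - t\<close> is at least 1.\<close>
lemma abs_sin_mult_le:
  assumes "0 \<le> t" "t \<le> pi"
  shows "\<bar>sin (real k * t)\<bar> \<le> real k * (t * (pi - t))"
proof -
  have a: "\<bar>sin (real k * t)\<bar> \<le> real k * t"
    using abs_sin_x_le_abs_x[of "real k * t"] assms by simp
  have "real k * (pi - t) = real k * pi - real k * t" by (simp add: algebra_simps)
  then have "\<bar>sin (real k * t)\<bar> = \<bar>sin (real k * (pi - t))\<bar>"
    by (simp add: sin_diff abs_mult)
  also have "\<dots> \<le> real k * (pi - t)"
    using abs_sin_x_le_abs_x[of "real k * (pi - t)"] assms by simp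
  finally have b: "\<bar>sin (real k * t)\<bar> \<le> real k * (pi - t)" .
  show ?thesis
  proof (cases "t \<ge> 1")
    case True
    then have "real k * (pi - t) * 1 \<le> real k * (pi - t) * t"
      using assms by (intro mult_left_mono) auto
    with b show ?thesis by (simp add: algebra_simps)
  next
    case False
    then have "real k * t * 1 \<le> real k * t * (pi - t)"
      using assms pi_gt3 by (intro mult_left_mono) auto
    with a show ?thesis by (simp add: algebra_simps)
  qed
qed

text \<open>
  The derivative of the cutoff is of size \<open>m\<close> near the end points. The sine, being at most
  \<open>k t (\<pi> - t) = k (s + 1) / m\<close>, cancels exactly this factor. What remains is a function of \<open>s\<close>,
  up to a constant, that is bounded and tends to 0 at infinity.
\<close>
lemma abs_sin_mult_cutoff'_le:
  assumes "0 \<le> t" "t \<le> pi"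
  defines "s \<equiv> \<lambda>m. real m * (t * (pi - t)) - 1"
  shows "\<bar>sin (real k * t) * cutoff' m t\<bar> \<le> real k * pi * (flat_power 1 (s m) + flat_power 2 (s m))"
proof -
  have "\<bar>sin (real k * t) * cutoff' m t\<bar> =
      \<bar>sin (real k * t)\<bar> * (flat_power 2 (s m) * (real m * \<bar>pi - 2 * t\<bar>))"
    by (simp add: cutoff'_def abs_mult s_def flat_power_nonneg)
  also have "\<dots> \<le> (real k * (t * (pi - t))) * (flat_power 2 (s m) * (real m * pi))"
    using assms by (intro mult_mono abs_sin_mult_le mult_nonneg_nonneg flat_power_nonneg) auto
  also have "\<dots> = real k * pi * ((s m + 1) * flat_power 2 (s m))"
    by (simp add: s_def)
  also have "(s m + 1) * flat_power 2 (s m) = flat_power 1 (s m) + flat_power 2 (s m)"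
    by (simp add: flat_power_def power2_eq_square field_simps)
  finally show ?thesis .
qed

lemma sin_mult_cutoff'_bounded:
  assumes "0 \<le> t" "t \<le> pi"
  shows "\<bar>sin (real k * t) * cutoff' m t\<bar> \<le> real k * pi * 3"
proof -
  have "flat_power 1 s + flat_power 2 s \<le> 3" for s
    using flat_power_le[of 1 s 0] flat_power_le[of 2 s 0] by (simp add: fact_2)
  then show ?thesis
    by (intro order.trans[OF abs_sin_mult_cutoff'_le[OF assms]] mult_left_mono) auto
qed

lemma flat_power_tendsto_0:
  assumes "j > 0" shows "(flat_power j \<longlongrightarrow> 0) at_top"
proof (rule Lim_null_comparison)
  have "norm (flat_power j s) \<le> inverse s ^ j" if "s > 0" for s
    using that by (simp add: flat_power_def abs_mult)
  then show "\<forall>\<^sub>F s in at_top. norm (flat_power j s) \<le> inverse s ^ j"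
    using eventually_gt_at_top[of "0::real"] by (rule eventually_mono[rotated])
  have "((\<lambda>s::real. inverse s ^ j) \<longlongrightarrow> 0 ^ j) at_top"
    by (intro tendsto_intros tendsto_inverse_0_at_top filterlim_ident)
  then show "((\<lambda>s::real. inverse s ^ j) \<longlongrightarrow> 0) at_top"
    using assms by (metis zero_power)
qed

lemma sin_mult_cutoff'_tendsto_0:
  assumes "0 < t" "t < pi" shows "(\<lambda>m. sin (real k * t) * cutoff' m t) \<longlonglongrightarrow> 0"
proof (rule Lim_null_comparison)
  define s where "s = (\<lambda>m. real m * (t * (pi - t)) - 1)"
  show "\<forall>\<^sub>F m in sequentially. norm (sin (real k * t) * cutoff' m t) \<le>
      real k * pi * (flat_power 1 (s m) + flat_power 2 (s m))"
    using abs_sin_mult_cutoff'_le[of t k] assms by (intro always_eventually) (auto simp: s_def)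
  have "t * (pi - t) > 0" using assms by simp
  then have 1: "filterlim s at_top sequentially"
    unfolding s_def by real_asymp
  have "(\<lambda>m. real k * pi * (flat_power 1 (s m) + flat_power 2 (s m))) \<longlonglongrightarrow> real k * pi * (0 + 0)"
    by (intro tendsto_intros filterlim_compose[OF flat_power_tendsto_0 1]) auto
  then show "(\<lambda>m. real k * pi * (flat_power 1 (s m) + flat_power 2 (s m))) \<longlonglongrightarrow> 0"
    by simp
qed

lemma cutoff_support:
  assumes "\<not> (1 / (real m * pi) \<le> t \<and> t \<le> pi - 1 / (real m * pi))"
  shows "cutoff m t = 0"
proof (cases "real m * (t * (pi - t)) \<le> 1")
  case False
  then have "0 < real m * (t * (pi - t))"
    by simp
  then have m: "m > 0" and "0 < t * (pi - t)"
    by (auto simp: zero_less_mult_iff)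
  then have t: "0 < t" "t < pi"
    using pi_gt_zero by (auto simp: zero_less_mult_iff simp del: pi_gt_zero)
  then have "1 < real m * pi * t" "1 < real m * pi * (pi - t)"
    using False mult_left_mono[of "t * (pi - t)" "pi * t" "real m"]
      mult_left_mono[of "t * (pi - t)" "pi * (pi - t)" "real m"]
    by (auto simp: mult.assoc not_le)
  then have "1 / (real m * pi) \<le> t" "1 / (real m * pi) \<le> pi - t"
    using m by (auto simp: divide_le_eq mult.commute)
  with assms show ?thesis by simp
qed (simp add: cutoff_def flat_power_def)

section \<open>Products of functions of one coordinate\<close>
definition tensor :: "('n::finite \<Rightarrow> real \<Rightarrow> real) \<Rightarrow> real ^ 'n \<Rightarrow> real" where
  "tensor f x = (\<Prod>i\<in>UNIV. f i (x $ i))"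

lemma tensor_fun_upd: "tensor (f(i := g)) x = g (x $ i) * (\<Prod>j\<in>UNIV - {i}. f j (x $ j))"
  by (subst tensor_def, subst prod.remove[of _ i]) (auto intro!: prod.cong)

lemma tensor_has_derivative:
  fixes f f' :: "'n::finite \<Rightarrow> real \<Rightarrow> real"
  assumes "\<And>i. (f i has_real_derivative f' i (x $ i)) (at (x $ i))"
  shows "(tensor f has_derivative (\<lambda>h. \<Sum>i\<in>UNIV. h $ i * tensor (f(i := f' i)) x)) (at x)"
proof -
  have "((\<lambda>x. f i (x $ i)) has_derivative (\<lambda>h. h $ i * f' i (x $ i))) (at x)" for i
  proof -
    have "((\<lambda>x::real^'n. x $ i) has_derivative (\<lambda>h. h $ i)) (at x)"
      by (rule bounded_linear_imp_has_derivative) (rule bounded_linear_vec_nth)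
    then have "((\<lambda>x. f i (x $ i)) has_derivative (\<lambda>h. f' i (x $ i) * h $ i)) (at x)"
      using assms[of i] unfolding has_field_derivative_def by (rule has_derivative_compose)
    then show ?thesis
      by (simp add: mult.commute)
  qed
  then have "((\<lambda>x. \<Prod>i\<in>UNIV. f i (x $ i)) has_derivative
      (\<lambda>h. \<Sum>i\<in>UNIV. (h $ i * f' i (x $ i)) * (\<Prod>j\<in>UNIV - {i}. f j (x $ j)))) (at x)"
    by (intro has_derivative_prod)
  moreover have "tensor f = (\<lambda>x. \<Prod>i\<in>UNIV. f i (x $ i))"
    by (simp add: tensor_def fun_eq_iff)
  ultimately show ?thesis
    by (simp add: tensor_fun_upd mult.assoc)
qed

lemma partial_deriv_tensor:
  fixes f f' :: "'n::finite \<Rightarrow> real \<Rightarrow> real"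
  assumes "\<And>i t. (f i has_real_derivative f' i t) (at t)"
  shows "partial_deriv (axis i 1) (tensor f) = tensor (f(i := f' i))"
proof
  fix x
  have "frechet_derivative (tensor f) (at x) = (\<lambda>h. \<Sum>i\<in>UNIV. h $ i * tensor (f(i := f' i)) x)"
    by (rule frechet_derivative_at[symmetric], rule tensor_has_derivative, rule assms)
  then show "partial_deriv (axis i 1) (tensor f) x = tensor (f(i := f' i)) x"
    by (simp add: partial_deriv_def axis_def if_distrib[of "\<lambda>a. a * _"] cong: if_cong)
qed

text \<open>
  A partial derivative of a product of functions of single coordinates is again such a product, so
  these products form a class that is stable under the coinductive rule for \<open>smooth\<close>.
\<close>
lemma smooth_tensor:
  assumes "\<And>i. smooth_real (f i)" shows "smooth (tensor f)"
  using assms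
proof (coinduction arbitrary: f)
  case smooth
  have "tensor f differentiable at x" for x
    using tensor_has_derivative[of f "\<lambda>i. deriv (f i)"] smooth smooth_real_derivative(1)
    unfolding differentiable_def by blast
  moreover have "\<exists>h. partial_deriv e (tensor f) = tensor h \<and> (\<forall>i. smooth_real (h i))"
    if e: "e \<in> Basis" for e :: "real^'a"
  proof -
    obtain i where "e = axis i 1"
      using e by (auto simp: Basis_vec_def)
    then have "partial_deriv e (tensor f) = tensor (f(i := deriv (f i)))"
      using partial_deriv_tensor[of f "\<lambda>i. deriv (f i)"] smooth smooth_real_derivative(1) by blast
    then show ?thesis
      using smooth smooth_real_derivative(2) by (intro exI[of _ "f(i := deriv (f i))"]) auto
  qed
  ultimately show ?case by auto
qed

section \<open>Integration by parts against test functions\<close>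
lemma lborel_integral_translate:
  fixes f :: "'a::euclidean_space \<Rightarrow> real"
  assumes "f \<in> borel_measurable borel"
  shows "(\<integral>x. f (x + a) \<partial>lborel) = (\<integral>x. f x \<partial>lborel)"
proof -
  have "(\<integral>x. f x \<partial>lborel) = (\<integral>x. f x \<partial>distr lborel borel ((+) a))"
    by (simp add: lborel_distr_plus)
  also have "\<dots> = (\<integral>x. f (a + x) \<partial>lborel)"
    using assms by (intro integral_distr) auto
  finally show ?thesis by (simp add: add.commute)
qed

lemma integrable_lborel_compact_support:
  fixes f :: "'a::euclidean_space \<Rightarrow> real"
  assumes "continuous_on UNIV f" "\<And>x. R < norm x \<Longrightarrow> f x = 0"
  shows "integrable lborel f"
proof -
  have "integrable lborel (\<lambda>x. indicator (cball 0 R) x *\<^sub>R f x)"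
    by (intro borel_integrable_compact) (auto intro: continuous_on_subset[OF assms(1)])
  also have "(\<lambda>x. indicator (cball 0 R) x *\<^sub>R f x) = f"
    using assms(2) by (auto simp: indicator_def fun_eq_iff not_le)
  finally show ?thesis .
qed

text \<open>
  The difference quotients of \<open>F\<close> along \<open>v\<close> have integral 0 by translation invariance; they are
  dominated by a multiple of the indicator of a ball and converge to the directional derivative.
\<close>
lemma integral_directional_derivative_0:
  fixes F :: "'a::euclidean_space \<Rightarrow> real"
  assumes D: "\<And>x. (F has_derivative F' x) (at x)"
    and cont: "continuous_on UNIV (\<lambda>x. F' x v)"
    and supp: "\<And>x. R < norm x \<Longrightarrow> F x = 0"
  shows "(\<integral>x. F' x v \<partial>lebesgue) = 0"
proof -
  define h :: "nat \<Rightarrow> real" where "h m = inverse (real (Suc m))" for m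
  have h: "h m > 0" "h m \<le> 1" for m
    by (auto simp: h_def inverse_le_1_iff)
  define s where "s m x = (F (x + h m *\<^sub>R v) - F x) / h m" for m x
  have contF: "continuous_on UNIV F"
    using D by (meson continuous_at_imp_continuous_on has_derivative_continuous)
  have Fm[measurable]: "F \<in> borel_measurable borel" "(\<lambda>x. F' x v) \<in> borel_measurable borel"
    using contF cont by (auto intro: borel_measurable_continuous_onI)
  have line: "((\<lambda>t. F (x + t *\<^sub>R v)) has_real_derivative F' (x + t *\<^sub>R v) v) (at t)" for x t
  proof -
    have "((\<lambda>t. x + t *\<^sub>R v) has_derivative (\<lambda>h. h *\<^sub>R v)) (at t)"
      by (auto intro!: derivative_eq_intros)
    then have "((\<lambda>t. F (x + t *\<^sub>R v)) has_derivative (\<lambda>h. F' (x + t *\<^sub>R v) (h *\<^sub>R v))) (at t)"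
      using D by (rule has_derivative_compose)
    moreover have "F' (x + t *\<^sub>R v) (h *\<^sub>R v) = F' (x + t *\<^sub>R v) v * h" for h
      using linear_cmul[OF has_derivative_linear[OF D]] by (simp add: mult.commute)
    ultimately show ?thesis
      by (simp add: has_field_derivative_def)
  qed
  define R' where "R' = R + 2 * norm v"
  have "bounded ((\<lambda>x. F' x v) ` cball 0 R')"
    by (intro compact_imp_bounded compact_continuous_image continuous_on_subset[OF cont]) auto
  then obtain M where M: "\<And>x. norm x \<le> R' \<Longrightarrow> \<bar>F' x v\<bar> \<le> M"
    unfolding bounded_iff by (force simp: dist_norm)
  have M0: "0 \<le> M" if "norm x \<le> R'" for x :: 'a
    using M[OF that] by linarith
  have hv: "norm (t *\<^sub>R v) \<le> norm v" if "0 \<le> t" "t \<le> h m" for t m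
    using that h[of m] by (simp add: mult_left_le_one_le)
  have bound: "norm (s m x) \<le> indicator (cball 0 R') x * M" for m x
  proof (cases "norm x \<le> R + norm v")
    case True
    obtain t where t: "0 < t" "t < h m" and
      eq: "F (x + h m *\<^sub>R v) - F (x + 0 *\<^sub>R v) = (h m - 0) * F' (x + t *\<^sub>R v) v"
      using MVT2[of 0 "h m" "\<lambda>t. F (x + t *\<^sub>R v)" "\<lambda>t. F' (x + t *\<^sub>R v) v"] line h by blast
    then have "s m x = F' (x + t *\<^sub>R v) v"
      using h[of m] by (simp add: s_def)
    moreover have "norm (x + t *\<^sub>R v) \<le> R'"
      using hv[of t m] t True norm_triangle_ineq[of x "t *\<^sub>R v"] by (simp add: R'_def)
    moreover have "norm x \<le> R'"
      using True norm_ge_zero[of v] unfolding R'_def by linarith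
    ultimately show ?thesis
      using M by simp
  next
    case False
    have "norm x \<le> norm (x + h m *\<^sub>R v) + norm (h m *\<^sub>R v)"
      by (metis add_diff_cancel_right' norm_triangle_ineq4)
    moreover have "norm (h m *\<^sub>R v) \<le> norm v"
      using hv[of "h m" m] h(1)[of m] by (simp only: order_less_imp_le order_refl)
    ultimately have "R < norm (x + h m *\<^sub>R v)" "R < norm x"
      using False norm_ge_zero[of v] by linarith+
    then have "s m x = 0"
      unfolding s_def by (simp only: supp) simp
    moreover have "0 \<le> indicator (cball 0 R') x * M"
      using M0[of x] by (cases "norm x \<le> R'") (simp_all add: indicator_def)
    ultimately show ?thesis by simp
  qed
  have lim: "(\<lambda>m. s m x) \<longlonglongrightarrow> F' x v" for x
  proof -
    have "((\<lambda>t. (F (x + t *\<^sub>R v) - F x) / t) \<longlongrightarrow> F' x v) (at 0)"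
      using line[of x 0] by (simp add: DERIV_def)
    moreover have "filterlim h (at 0) sequentially"
      unfolding filterlim_at h_def using LIMSEQ_inverse_real_of_nat by auto
    ultimately show ?thesis
      unfolding s_def by (rule filterlim_compose)
  qed
  have "(\<lambda>m. \<integral>x. s m x \<partial>lborel) \<longlonglongrightarrow> (\<integral>x. F' x v \<partial>lborel)"
  proof (rule integral_dominated_convergence[where w = "\<lambda>x. indicator (cball 0 R') x * M"])
    show "integrable lborel (\<lambda>x. indicat_real (cball 0 R') x * M)"
      by (intro integrable_mult_left integrable_real_indicator)
        (use emeasure_bounded_finite[of "cball 0 R'"] in auto)
  qed (use bound lim in \<open>auto simp: s_def[abs_def]\<close>)
  moreover have "(\<integral>x. s m x \<partial>lborel) = 0" for m
  proof -
    have i: "integrable lborel F"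
      using contF supp by (rule integrable_lborel_compact_support)
    have c: "continuous_on UNIV (\<lambda>x. F (x + h m *\<^sub>R v))"
      by (intro continuous_on_compose2[OF contF] continuous_intros) auto
    have i2: "integrable lborel (\<lambda>x. F (x + h m *\<^sub>R v))"
    proof (rule integrable_lborel_compact_support[OF c, of "R + norm v"])
      fix x :: 'a assume "R + norm v < norm x"
      moreover have "norm x \<le> norm (x + h m *\<^sub>R v) + norm (h m *\<^sub>R v)"
        by (metis add_diff_cancel_right' norm_triangle_ineq4)
      ultimately show "F (x + h m *\<^sub>R v) = 0"
        using hv[of "h m" m] h(1)[of m] by (intro supp) linarith
    qed
    have "(\<integral>x. s m x \<partial>lborel) = ((\<integral>x. F (x + h m *\<^sub>R v) \<partial>lborel) - (\<integral>x. F x \<partial>lborel)) / h m"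
      unfolding s_def using i i2 by simp
    then show ?thesis
      by (simp add: lborel_integral_translate)
  qed
  ultimately have "(\<integral>x. F' x v \<partial>lborel) = 0"
    by (simp add: LIMSEQ_const_iff)
  then show ?thesis
    by (subst integral_completion) auto
qed

lemma smooth_imp:
  assumes "smooth \<phi>"
  shows "(\<phi> has_derivative frechet_derivative \<phi> (at x)) (at x)"
    and "i \<in> Basis \<Longrightarrow> continuous_on UNIV (partial_deriv i \<phi>)"
    and "continuous_on UNIV \<phi>"
proof -
  have *: "\<psi> differentiable (at x)" if "smooth \<psi>" for x and \<psi> :: "'a \<Rightarrow> real"
    using that by (cases rule: smooth.cases) auto
  have **: "continuous_on UNIV \<psi>" if "smooth \<psi>" for \<psi> :: "'a \<Rightarrow> real"
    using *[OF that] by (simp add: continuous_on_eq_continuous_within differentiable_imp_continuous_within)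
  show "(\<phi> has_derivative frechet_derivative \<phi> (at x)) (at x)"
    using *[OF assms] by (simp add: frechet_derivative_works)
  show "continuous_on UNIV \<phi>" using ** assms .
  show "continuous_on UNIV (partial_deriv i \<phi>)" if "i \<in> Basis"
    using assms that by (cases rule: smooth.cases) (auto intro: **)
qed

lemma partial_deriv_outside_support:
  fixes \<phi> :: "'a::euclidean_space \<Rightarrow> real"
  assumes "x \<notin> closure {x. \<phi> x \<noteq> 0}" shows "partial_deriv i \<phi> x = 0"
proof -
  have "((\<lambda>x. 0) has_derivative (\<lambda>h. 0)) (at x)" by simp
  then have "(\<phi> has_derivative (\<lambda>h. 0)) (at x)"
    by (rule has_derivative_transform_within_open[of _ _ _ _ "- closure {x. \<phi> x \<noteq> 0}"])
      (use assms closure_subset[of "{x. \<phi> x \<noteq> 0}"] in auto)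
  then show ?thesis
    by (simp add: partial_deriv_def frechet_derivative_at[symmetric])
qed

lemma integration_by_parts_test_function:
  fixes u :: "'a::euclidean_space \<Rightarrow> real"
  assumes test: "test_function \<Omega> \<phi>" and i: "i \<in> Basis"
    and u: "\<And>x. (u has_derivative u' x) (at x)" and cont: "continuous_on UNIV (\<lambda>x. u' x i)"
  shows "(LINT x:\<Omega>|lebesgue. u x * partial_deriv i \<phi> x) = - (LINT x:\<Omega>|lebesgue. u' x i * \<phi> x)"
proof -
  have sm: "smooth \<phi>" and cpt: "compact (closure {x. \<phi> x \<noteq> 0})" and
    sub: "closure {x. \<phi> x \<noteq> 0} \<subseteq> \<Omega>"
    using test by (auto simp: test_function_def)
  have off: "\<phi> x = 0" "partial_deriv i \<phi> x = 0" if "x \<notin> closure {x. \<phi> x \<noteq> 0}" for x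
    using that subsetD[OF closure_subset, of x "{x. \<phi> x \<noteq> 0}"] partial_deriv_outside_support[of x \<phi> i] by auto
  obtain R where R: "\<And>x. x \<in> closure {x. \<phi> x \<noteq> 0} \<Longrightarrow> norm x \<le> R"
    using compact_imp_bounded[OF cpt] by (auto simp: bounded_iff)
  have out: "\<phi> x = 0" "partial_deriv i \<phi> x = 0" if "R < norm x" for x
    using that R[of x] by (auto intro!: off)
  have contu: "continuous_on UNIV u"
    using u by (meson continuous_at_imp_continuous_on has_derivative_continuous)
  note sm' = smooth_imp[OF sm]
  have "((\<lambda>x. u x * \<phi> x) has_derivative
      (\<lambda>h. u x * frechet_derivative \<phi> (at x) h + u' x h * \<phi> x)) (at x)" for x
    by (rule has_derivative_mult[OF u sm'(1)])
  from integral_directional_derivative_0[OF this, of i R]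
  have "(\<integral>x. u x * partial_deriv i \<phi> x + u' x i * \<phi> x \<partial>lebesgue) = 0"
    using out continuous_on_add[OF continuous_on_mult[OF contu sm'(2)[OF i]] continuous_on_mult[OF cont sm'(3)]]
    unfolding partial_deriv_def by auto
  moreover have "integrable lborel (\<lambda>x. u x * partial_deriv i \<phi> x)"
    by (rule integrable_lborel_compact_support[of _ R])
      (use out i in \<open>auto intro!: continuous_intros contu cont sm'(2,3)\<close>)
  moreover have "integrable lborel (\<lambda>x. u' x i * \<phi> x)"
    by (rule integrable_lborel_compact_support[of _ R])
      (use out i in \<open>auto intro!: continuous_intros contu cont sm'(2,3)\<close>)
  ultimately have "(\<integral>x. u x * partial_deriv i \<phi> x \<partial>lebesgue) = - (\<integral>x. u' x i * \<phi> x \<partial>lebesgue)"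
    using Bochner_Integration.integral_add[of lebesgue "\<lambda>x. u x * partial_deriv i \<phi> x" "\<lambda>x. u' x i * \<phi> x"]
    by (simp add: integrable_completion borel_measurable_integrable)
  moreover have "indicat_real \<Omega> x *\<^sub>R (u x * partial_deriv i \<phi> x) = u x * partial_deriv i \<phi> x"
    "indicat_real \<Omega> x *\<^sub>R (u' x i * \<phi> x) = u' x i * \<phi> x" for x
    using off[of x] sub by (auto simp: indicator_def)
  ultimately show ?thesis
    unfolding set_lebesgue_integral_def by (simp only:)
qed

section \<open>Square integrable functions\<close>
lemma square_integrable_mult:
  assumes "square_integrable_on \<Omega> u" "square_integrable_on \<Omega> v"
  shows "set_integrable lebesgue \<Omega> (\<lambda>x. u x * v x)"
proof -
  let ?i = "\<lambda>f x. indicat_real \<Omega> x *\<^sub>R f x"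
  have m: "?i u \<in> borel_measurable lebesgue" "?i v \<in> borel_measurable lebesgue"
    and i: "integrable lebesgue (\<lambda>x. ?i (\<lambda>x. (u x)\<^sup>2) x + ?i (\<lambda>x. (v x)\<^sup>2) x)"
    using assms by (auto simp: square_integrable_on_def set_borel_measurable_def set_integrable_def)
  have "(\<lambda>x. ?i u x * ?i v x) \<in> borel_measurable lebesgue"
    using m by measurable
  moreover have "(\<lambda>x. ?i u x * ?i v x) = ?i (\<lambda>x. u x * v x)"
    by (auto simp: indicator_def)
  ultimately have m: "?i (\<lambda>x. u x * v x) \<in> borel_measurable lebesgue" by simp
  have "\<bar>a * b\<bar> \<le> a\<^sup>2 + b\<^sup>2" for a b :: real
    using sum_squares_bound[of "\<bar>a\<bar>" "\<bar>b\<bar>"] abs_ge_zero[of "a * b"]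
    unfolding abs_mult power2_abs mult.assoc by linarith
  then show ?thesis
    unfolding set_integrable_def
    by (intro Bochner_Integration.integrable_bound[OF i m]) (auto simp: indicator_def)
qed

lemma square_integrable_add:
  assumes "square_integrable_on \<Omega> u" "square_integrable_on \<Omega> v"
  shows "square_integrable_on \<Omega> (\<lambda>x. u x + v x)"
  unfolding square_integrable_on_def
proof
  have "set_borel_measurable lebesgue \<Omega> u" "set_borel_measurable lebesgue \<Omega> v"
    using assms by (auto simp: square_integrable_on_def)
  then show "set_borel_measurable lebesgue \<Omega> (\<lambda>x. u x + v x)"
    unfolding set_borel_measurable_def scaleR_add_right by measurable
  have "set_integrable lebesgue \<Omega> (\<lambda>x. u x * u x + 2 * (u x * v x) + v x * v x)"
    using assms by (intro set_integral_add set_integrable_mult_right square_integrable_mult)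
  then show "set_integrable lebesgue \<Omega> (\<lambda>x. (u x + v x)\<^sup>2)"
    by (simp add: power2_eq_square algebra_simps)
qed

lemma square_integrable_cmult:
  assumes "square_integrable_on \<Omega> u"
  shows "square_integrable_on \<Omega> (\<lambda>x. c * u x)"
  unfolding square_integrable_on_def
proof
  have "set_borel_measurable lebesgue \<Omega> u"
    using assms by (auto simp: square_integrable_on_def)
  then have "(\<lambda>x. c * (indicat_real \<Omega> x *\<^sub>R u x)) \<in> borel_measurable lebesgue"
    unfolding set_borel_measurable_def by measurable
  then show "set_borel_measurable lebesgue \<Omega> (\<lambda>x. c * u x)"
    unfolding set_borel_measurable_def by (simp add: mult.left_commute)
  show "set_integrable lebesgue \<Omega> (\<lambda>x. (c * u x)\<^sup>2)"
    using assms by (auto simp: square_integrable_on_def power_mult_distrib)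
qed

lemma continuous_on_imp_set_borel_measurable:
  fixes u :: "'a::euclidean_space \<Rightarrow> real"
  assumes "open \<Omega>" "continuous_on \<Omega> u"
  shows "set_borel_measurable lebesgue \<Omega> u"
proof -
  have "(\<lambda>x. indicat_real \<Omega> x *\<^sub>R u x) \<in> borel_measurable lborel"
    using borel_measurable_continuous_on_indicator[of \<Omega> u] assms by simp
  then show ?thesis
    unfolding set_borel_measurable_def by (rule measurable_completion)
qed

lemma square_integrable_bounded:
  fixes u :: "'a::euclidean_space \<Rightarrow> real"
  assumes "open \<Omega>" "bounded \<Omega>" "continuous_on \<Omega> u" "\<And>x. x \<in> \<Omega> \<Longrightarrow> \<bar>u x\<bar> \<le> M"
  shows "square_integrable_on \<Omega> u"
  unfolding square_integrable_on_def
proof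
  show "set_borel_measurable lebesgue \<Omega> u"
    using assms by (intro continuous_on_imp_set_borel_measurable)
  have *: "set_borel_measurable lebesgue \<Omega> (\<lambda>x. (u x)\<^sup>2)"
    using assms by (intro continuous_on_imp_set_borel_measurable continuous_intros) auto
  have "\<Omega> \<in> lmeasurable" using assms by (simp add: lmeasurable_open)
  then have "integrable lebesgue (\<lambda>x. indicat_real \<Omega> x * M\<^sup>2)"
    by (intro integrable_mult_left integrable_real_indicator) (auto simp: fmeasurable_def)
  then show "set_integrable lebesgue \<Omega> (\<lambda>x. (u x)\<^sup>2)"
    unfolding set_integrable_def
  proof (rule Bochner_Integration.integrable_bound)
    show "AE x in lebesgue. norm (indicat_real \<Omega> x *\<^sub>R (u x)\<^sup>2) \<le> norm (indicat_real \<Omega> x * M\<^sup>2)"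
      using assms(4) by (auto simp: indicator_def abs_le_square_iff[symmetric] intro!: always_eventually)
        (meson abs_ge_self order.trans)
  qed (use * in \<open>simp add: set_borel_measurable_def\<close>)
qed

lemma square_integrable_imp_set_integrable:
  fixes u :: "'a::euclidean_space \<Rightarrow> real"
  assumes "open \<Omega>" "bounded \<Omega>" "square_integrable_on \<Omega> u"
  shows "set_integrable lebesgue \<Omega> u"
proof -
  have "square_integrable_on \<Omega> (\<lambda>x. 1)"
    using assms by (intro square_integrable_bounded[of _ _ 1]) auto
  from square_integrable_mult[OF assms(3) this] show ?thesis by simp
qed

text \<open>
  The form of dominated convergence used to pass from test functions to their limits, with \<open>w\<close>
  an \<open>H\<^sup>1\<close> function or a component of its weak gradient.
\<close>
lemma set_integral_bounded_convergence:
  fixes w :: "'a::euclidean_space \<Rightarrow> real"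
  assumes w: "set_integrable lebesgue \<Omega> w" and "open \<Omega>"
    and s: "\<And>m. continuous_on \<Omega> (s m)" "\<And>m x. x \<in> \<Omega> \<Longrightarrow> \<bar>s m x\<bar> \<le> M"
      "\<And>x. x \<in> \<Omega> \<Longrightarrow> (\<lambda>m. s m x) \<longlonglongrightarrow> S x" "continuous_on \<Omega> S"
  shows "(\<lambda>m. LINT x:\<Omega>|lebesgue. w x * s m x) \<longlonglongrightarrow> (LINT x:\<Omega>|lebesgue. w x * S x)"
proof -
  let ?i = "\<lambda>f x. indicat_real \<Omega> x *\<^sub>R f x"
  have meas: "?i (\<lambda>x. w x * f x) \<in> borel_measurable lebesgue" if "continuous_on \<Omega> f" for f
  proof -
    have "?i w \<in> borel_measurable lebesgue"
      using w by (simp add: set_integrable_def borel_measurable_integrable)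
    moreover have "?i f \<in> borel_measurable lebesgue"
      using continuous_on_imp_set_borel_measurable[OF \<open>open \<Omega>\<close> that]
      by (simp add: set_borel_measurable_def)
    ultimately have "(\<lambda>x. ?i w x * ?i f x) \<in> borel_measurable lebesgue"
      by measurable
    moreover have "(\<lambda>x. ?i w x * ?i f x) = ?i (\<lambda>x. w x * f x)"
      by (auto simp: indicator_def)
    ultimately show ?thesis by simp
  qed
  show ?thesis
    unfolding set_lebesgue_integral_def
  proof (rule integral_dominated_convergence[where w = "\<lambda>x. M * norm (?i w x)"])
    show "integrable lebesgue (\<lambda>x. M * norm (?i w x))"
      using w by (intro integrable_mult_right integrable_norm) (simp add: set_integrable_def)
    show "AE x in lebesgue. norm (?i (\<lambda>x. w x * s m x) x) \<le> M * norm (?i w x)" for m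
      using s(2) by (intro always_eventually) (auto simp: indicator_def abs_mult mult.commute[of M] intro!: mult_left_mono)
    show "AE x in lebesgue. (\<lambda>m. ?i (\<lambda>x. w x * s m x) x) \<longlonglongrightarrow> ?i (\<lambda>x. w x * S x) x"
      using s(3) by (intro always_eventually) (auto simp: indicator_def intro!: tendsto_intros)
  qed (use meas s(1,4) in blast)+
qed

section \<open>Products of cosines and the Green formula\<close>
lemma hypercube_eq_box: "hypercube a = box 0 (\<chi> i. a)"
  by (auto simp: hypercube_def mem_box_cart)

lemma open_hypercube: "open (hypercube a)"
  and bounded_hypercube: "bounded (hypercube a)"
  by (simp_all add: hypercube_eq_box open_box)

lemma hypercube_sets [measurable, simp]: "hypercube a \<in> sets lebesgue"
  by (intro sets_completionI_sets) (simp add: borel_open[OF open_hypercube])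

lemma square_integrable_continuous:
  fixes f :: "real ^ 'n \<Rightarrow> real"
  assumes "continuous_on UNIV f" shows "square_integrable_on (hypercube a) f"
proof -
  have "bounded (f ` closure (hypercube a))"
    using assms bounded_hypercube
    by (intro compact_imp_bounded compact_continuous_image) (auto intro: continuous_on_subset)
  then obtain M where "\<forall>x\<in>closure (hypercube a). \<bar>f x\<bar> \<le> M"
    by (auto simp: bounded_iff)
  then show ?thesis
    using assms open_hypercube bounded_hypercube closure_subset[of "hypercube a"]
    by (intro square_integrable_bounded[of _ _ M]) (auto intro: continuous_on_subset)
qed

lemma tensor_continuous:
  assumes "\<And>i. continuous_on UNIV (f i)" shows "continuous_on UNIV (tensor f)"
proof -
  have "continuous_on UNIV (\<lambda>x. f i (x $ i))" for i
    by (intro continuous_on_compose2[OF assms] continuous_intros) auto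
  then have "continuous_on UNIV (\<lambda>x. \<Prod>i\<in>UNIV. f i (x $ i))"
    by (intro continuous_intros)
  then show ?thesis by (simp add: tensor_def[abs_def])
qed

lemma has_real_derivative_imp_continuous_on:
  assumes "\<And>t. (f has_real_derivative f' t) (at t)" shows "continuous_on UNIV f"
  using assms DERIV_isCont continuous_at_imp_continuous_on by blast

lemma abs_prod_le_1:
  fixes f :: "'i \<Rightarrow> real"
  assumes "\<And>i. i \<in> A \<Longrightarrow> \<bar>f i\<bar> \<le> 1" shows "\<bar>\<Prod>i\<in>A. f i\<bar> \<le> 1"
  unfolding abs_prod using assms by (intro prod_le_1) auto

lemma tensor_tendsto:
  assumes "\<And>i. (\<lambda>m. f m i (x $ i)) \<longlonglongrightarrow> g i (x $ i)"
  shows "(\<lambda>m. tensor (f m) x) \<longlonglongrightarrow> tensor g x"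
  unfolding tensor_def using assms by (intro tendsto_prod)

lemma test_function_tensor_cutoff:
  fixes f :: "'n::finite \<Rightarrow> real \<Rightarrow> real"
  assumes "\<And>i. smooth_real (f i)" "m > 0"
  shows "test_function (hypercube pi) (tensor (\<lambda>i t. f i t * cutoff m t))" (is "test_function _ ?\<phi>")
proof -
  define a where "a = 1 / (real m * pi)"
  have a: "a > 0" using assms by (simp add: a_def)
  have "{x. ?\<phi> x \<noteq> 0} \<subseteq> cbox (\<chi> i. a) (\<chi> i. pi - a)"
  proof
    fix x assume "x \<in> {x. ?\<phi> x \<noteq> 0}"
    then have "cutoff m (x $ i) \<noteq> 0" for i
      by (auto simp: tensor_def)
    then show "x \<in> cbox (\<chi> i. a) (\<chi> i. pi - a)"
      using cutoff_support[of m] unfolding mem_box_cart a_def vec_lambda_beta by blast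
  qed
  then have 1: "closure {x. ?\<phi> x \<noteq> 0} \<subseteq> cbox (\<chi> i. a) (\<chi> i. pi - a)"
    by (intro closure_minimal) auto
  also have "\<dots> \<subseteq> hypercube pi"
  proof
    fix x :: "real ^ 'n" assume "x \<in> cbox (\<chi> i. a) (\<chi> i. pi - a)"
    then have "a \<le> x $ i \<and> x $ i \<le> pi - a" for i
      by (simp add: mem_box_cart)
    then have "0 < x $ i \<and> x $ i < pi" for i
      using a by (meson diff_less_eq less_add_same_cancel1 order.strict_trans1 order.strict_trans2)
    then show "x \<in> hypercube pi"
      by (simp add: hypercube_def)
  qed
  finally show ?thesis
    using 1 assms smooth_tensor[of "\<lambda>i t. f i t * cutoff m t"]
    by (auto simp: test_function_def smooth_real_mult smooth_real_cutoff
        intro: bounded_subset[OF bounded_cbox] dest: order.trans[OF closure_subset])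
qed

definition cosine_product :: "('n::finite \<Rightarrow> nat) \<Rightarrow> real ^ 'n \<Rightarrow> real" where
  "cosine_product k = tensor (\<lambda>j t. cos (real (k j) * t))"

text \<open>Up to the factor \<open>- k i\<close>, this is the partial derivative of \<open>cosine_product k\<close> in direction \<open>i\<close>.\<close>
definition sine_cosine_product :: "'n::finite \<Rightarrow> ('n \<Rightarrow> nat) \<Rightarrow> real ^ 'n \<Rightarrow> real" where
  "sine_cosine_product i k = tensor ((\<lambda>j t. cos (real (k j) * t))(i := \<lambda>t. sin (real (k i) * t)))"

definition cosine_gradient :: "('n::finite \<Rightarrow> nat) \<Rightarrow> real ^ 'n \<Rightarrow> real ^ 'n" where
  "cosine_gradient k x = (\<chi> i. - real (k i) * sine_cosine_product i k x)"

lemma continuous_cosine_product: "continuous_on A (cosine_product k)"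
  unfolding cosine_product_def
  by (rule continuous_on_subset[OF tensor_continuous]) (auto intro!: continuous_intros)

lemma continuous_sine_cosine_product: "continuous_on A (sine_cosine_product i k)"
  unfolding sine_cosine_product_def
  by (rule continuous_on_subset[OF tensor_continuous]) (auto intro!: continuous_intros)

lemma cosine_product_has_derivative:
  "(cosine_product k has_derivative (\<lambda>h. cosine_gradient k x \<bullet> h)) (at x)"
proof -
  have "tensor ((\<lambda>j t. cos (real (k j) * t))(i := \<lambda>t. - real (k i) * sin (real (k i) * t))) x =
      cosine_gradient k x $ i" for i
    by (simp add: tensor_fun_upd cosine_gradient_def sine_cosine_product_def mult.assoc)
  moreover have "(cosine_product k has_derivative (\<lambda>h. \<Sum>i\<in>UNIV. h $ i *
      tensor ((\<lambda>j t. cos (real (k j) * t))(i := \<lambda>t. - real (k i) * sin (real (k i) * t))) x)) (at x)"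
    unfolding cosine_product_def
    by (rule tensor_has_derivative) (auto intro!: derivative_eq_intros)
  ultimately show ?thesis
    by (simp add: inner_vec_def mult.commute)
qed

lemma H1_cosine_product:
  fixes k :: "'n::finite \<Rightarrow> nat"
  shows "H1_with_gradient (hypercube a) (cosine_product k) (cosine_gradient k)"
  unfolding H1_with_gradient_def
proof (intro conjI ballI allI impI)
  show "square_integrable_on (hypercube a) (cosine_product k)"
    by (intro square_integrable_continuous continuous_cosine_product)
  fix e :: "real^'n" assume e: "e \<in> Basis"
  then obtain i where i: "e = axis i 1"
    by (auto simp: Basis_vec_def)
  have g: "cosine_gradient k x \<bullet> e = - real (k i) * sine_cosine_product i k x" for x
    by (simp add: i inner_axis cosine_gradient_def)
  have c: "continuous_on UNIV (\<lambda>x. cosine_gradient k x \<bullet> e)"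
    unfolding g by (intro continuous_intros continuous_sine_cosine_product)
  then show "square_integrable_on (hypercube a) (\<lambda>x. cosine_gradient k x \<bullet> e)"
    by (rule square_integrable_continuous)
  show "(LINT x:hypercube a|lebesgue. cosine_product k x * partial_deriv e \<phi> x) =
      - (LINT x:hypercube a|lebesgue. cosine_gradient k x \<bullet> e * \<phi> x)"
    if "test_function (hypercube a) \<phi>" for \<phi>
    using that e cosine_product_has_derivative c by (rule integration_by_parts_test_function)
qed

text \<open>
  The products \<open>\<phi> m\<close> of the factors with cutoffs are test functions and converge boundedly to
  \<open>sine_cosine_product i k\<close>. Their \<open>i\<close>-th derivatives converge boundedly to \<open>k i * cosine_product k\<close>, by
  the estimate for the sine times the derivative of the cutoff. Hence the identity defining the
  weak gradient passes to the limit although the limit function does not have compact support in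
  the cube.
\<close>
lemma Green_sine_cosine_product:
  fixes h :: "real ^ 'n::finite \<Rightarrow> real ^ 'n"
  assumes "H1_with_gradient (hypercube pi) w h"
  shows "(LINT x:hypercube pi|lebesgue. sine_cosine_product i k x * h x $ i) =
    - real (k i) * (LINT x:hypercube pi|lebesgue. cosine_product k x * w x)"
proof -
  let ?\<Omega> = "hypercube pi :: (real^'n) set"
  define e :: "real ^ 'n" where "e = axis i 1"
  have e: "e \<in> Basis" by (auto simp: e_def Basis_vec_def)
  have he: "h x \<bullet> e = h x $ i" for x by (simp add: e_def inner_axis)
  define f where "f = (\<lambda>j t. cos (real (k j) * t))(i := \<lambda>t. sin (real (k i) * t))"
  define f' where "f' = (\<lambda>m t. real (k i) * (cos (real (k i) * t) * cutoff m t) + sin (real (k i) * t) * cutoff' m t)"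
  define \<phi> where "\<phi> m = tensor (\<lambda>j t. f j t * cutoff m t)" for m
  define \<phi>' where "\<phi>' m = tensor ((\<lambda>j t. f j t * cutoff m t)(i := f' m))" for m
  have sm: "smooth_real (f j)" for j
    by (simp add: f_def smooth_real_sin smooth_real_cos)
  have sm': "smooth_real (\<lambda>t. f j t * cutoff m t)" for j m
    by (intro smooth_real_mult sm smooth_real_cutoff)
  have f1: "\<bar>f j t\<bar> \<le> 1" for j t by (simp add: f_def)
  have fc1: "\<bar>f j t * cutoff m t\<bar> \<le> 1" for j m t
    unfolding abs_mult using f1[of j t] cutoff_le_1[of m t] by (simp add: mult_le_one)
  have pd: "partial_deriv e (\<phi> m) = \<phi>' m" for m
  proof -
    have D: "((\<lambda>t. f j t * cutoff m t) has_real_derivative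
       (if j = i then f' m t else deriv (\<lambda>t. f j t * cutoff m t) t)) (at t)" for j t
    proof (cases "j = i")
      case True
      have "((\<lambda>t. sin (real (k i) * t) * cutoff m t) has_real_derivative f' m t) (at t)"
        by (auto intro!: derivative_eq_intros cutoff_has_derivative simp: f'_def algebra_simps)
      with True show ?thesis by (simp add: f_def)
    qed (simp add: smooth_real_derivative(1)[OF sm'])
    have "partial_deriv (axis i 1) (tensor (\<lambda>j t. f j t * cutoff m t)) =
      tensor ((\<lambda>j t. f j t * cutoff m t)(i := \<lambda>t. if i = i then f' m t else deriv (\<lambda>t. f i t * cutoff m t) t))"
      using D by (rule partial_deriv_tensor)
    then show ?thesis
      by (simp add: \<phi>_def \<phi>'_def e_def)
  qed
  \<comment> \<open>The index is shifted because the compact box containing the support is available for \<open>m > 0\<close>.\<close>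
  have test: "test_function ?\<Omega> (\<phi> (Suc m))" for m
    unfolding \<phi>_def by (intro test_function_tensor_cutoff sm) auto
  have sq: "square_integrable_on ?\<Omega> w" "square_integrable_on ?\<Omega> (\<lambda>x. h x \<bullet> e)"
    and eq: "(LINT x:?\<Omega>|lebesgue. w x * \<phi>' (Suc m) x) = - (LINT x:?\<Omega>|lebesgue. (h x \<bullet> e) * \<phi> (Suc m) x)" for m
    using assms e test[of m] unfolding H1_with_gradient_def pd[symmetric] by blast+
  note int = sq[THEN square_integrable_imp_set_integrable[OF open_hypercube bounded_hypercube]]
  have x: "0 < x $ j" "x $ j < pi" if "x \<in> ?\<Omega>" for x j
    using that by (auto simp: hypercube_def)
  have contf: "continuous_on UNIV (\<lambda>t. f j t * cutoff m t)" for j m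
    using smooth_real_derivative(1)[OF sm'] by (rule has_real_derivative_imp_continuous_on)
  have contf': "continuous_on UNIV (f' m)" for m
  proof -
    note [continuous_intros] = has_real_derivative_imp_continuous_on[OF cutoff_has_derivative]
    then show ?thesis
      unfolding f'_def cutoff'_def
      by (intro continuous_intros
          continuous_on_compose2[OF has_real_derivative_imp_continuous_on[OF flat_power_has_derivative]]) auto
  qed
  have lim1: "(\<lambda>m. LINT x:?\<Omega>|lebesgue. (h x \<bullet> e) * \<phi> (Suc m) x) \<longlonglongrightarrow>
      (LINT x:?\<Omega>|lebesgue. (h x \<bullet> e) * sine_cosine_product i k x)"
  proof (rule set_integral_bounded_convergence[OF int(2) open_hypercube])
    show "continuous_on ?\<Omega> (\<phi> (Suc m))" for m
      unfolding \<phi>_def by (rule continuous_on_subset[OF tensor_continuous]) (auto intro: contf)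
    show "\<bar>\<phi> (Suc m) x\<bar> \<le> 1" for m x
      unfolding \<phi>_def tensor_def by (intro abs_prod_le_1 fc1)
    show "(\<lambda>m. \<phi> (Suc m) x) \<longlonglongrightarrow> sine_cosine_product i k x" if "x \<in> ?\<Omega>" for x
    proof -
      have "(\<lambda>m. f j (x $ j) * cutoff m (x $ j)) \<longlonglongrightarrow> f j (x $ j)" for j
        using tendsto_mult[OF tendsto_const cutoff_tendsto[OF x[OF that]], of "f j (x $ j)"] by simp
      then show ?thesis
        unfolding \<phi>_def sine_cosine_product_def f_def[symmetric]
        by (intro tensor_tendsto LIMSEQ_Suc)
    qed
  qed (rule continuous_sine_cosine_product)
  have lim2: "(\<lambda>m. LINT x:?\<Omega>|lebesgue. w x * \<phi>' (Suc m) x) \<longlonglongrightarrow>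
      (LINT x:?\<Omega>|lebesgue. w x * (real (k i) * cosine_product k x))"
  proof (rule set_integral_bounded_convergence[OF int(1) open_hypercube])
    show "continuous_on ?\<Omega> (\<phi>' (Suc m))" for m
      unfolding \<phi>'_def by (rule continuous_on_subset[OF tensor_continuous]) (auto intro: contf contf')
    show "\<bar>\<phi>' (Suc m) x\<bar> \<le> real (k i) + real (k i) * pi * 3" if "x \<in> ?\<Omega>" for m x
    proof -
      let ?t = "x $ i"
      have "\<bar>cos (real (k i) * ?t) * cutoff (Suc m) ?t\<bar> \<le> 1"
        unfolding abs_mult using cutoff_le_1[of "Suc m" ?t] by (simp add: mult_le_one)
      then have "\<bar>real (k i) * (cos (real (k i) * ?t) * cutoff (Suc m) ?t)\<bar> \<le> real (k i)"
        by (simp add: abs_mult mult_left_le)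
      moreover have "\<bar>sin (real (k i) * ?t) * cutoff' (Suc m) ?t\<bar> \<le> real (k i) * pi * 3"
        using x[OF that, of i] by (intro sin_mult_cutoff'_bounded) auto
      ultimately have "\<bar>f' (Suc m) ?t\<bar> \<le> real (k i) + real (k i) * pi * 3"
        unfolding f'_def by linarith
      moreover have "\<bar>\<Prod>j\<in>UNIV - {i}. f j (x $ j) * cutoff (Suc m) (x $ j)\<bar> \<le> 1"
        by (intro abs_prod_le_1 fc1)
      ultimately have "\<bar>f' (Suc m) ?t\<bar> * \<bar>\<Prod>j\<in>UNIV - {i}. f j (x $ j) * cutoff (Suc m) (x $ j)\<bar>
          \<le> (real (k i) + real (k i) * pi * 3) * 1"
        by (intro mult_mono) auto
      then show ?thesis
        unfolding \<phi>'_def tensor_fun_upd abs_mult by simp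
    qed
    show "(\<lambda>m. \<phi>' (Suc m) x) \<longlonglongrightarrow> real (k i) * cosine_product k x" if "x \<in> ?\<Omega>" for x
    proof -
      let ?g = "\<lambda>j t. if j = i then real (k i) * cos (real (k i) * t) else cos (real (k j) * t)"
      have c: "(\<lambda>m. cutoff m (x $ j)) \<longlonglongrightarrow> 1" for j
        using cutoff_tendsto[OF x[OF that]] .
      have "(\<lambda>m. ((\<lambda>j t. f j t * cutoff m t)(i := f' m)) j (x $ j)) \<longlonglongrightarrow> ?g j (x $ j)" for j
      proof (cases "j = i")
        case True
        have "(\<lambda>m. f' m (x $ i)) \<longlonglongrightarrow> real (k i) * (cos (real (k i) * x $ i) * 1) + 0"
          unfolding f'_def
          by (intro tendsto_intros c sin_mult_cutoff'_tendsto_0 x that)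
        with True show ?thesis by simp
      next
        case False
        then show ?thesis
          using tendsto_mult[OF tendsto_const c[of j], of "f j (x $ j)"] by (simp add: f_def)
      qed
      then have "(\<lambda>m. \<phi>' (Suc m) x) \<longlonglongrightarrow> tensor ?g x"
        unfolding \<phi>'_def by (intro tensor_tendsto LIMSEQ_Suc)
      moreover have "tensor ?g x = real (k i) * cosine_product k x"
        unfolding tensor_def cosine_product_def
        by (subst (1 2) prod.remove[of _ i]) (auto intro!: prod.cong)
      ultimately show ?thesis by simp
    qed
  qed (intro continuous_intros continuous_cosine_product)
  have "(LINT x:?\<Omega>|lebesgue. w x * (real (k i) * cosine_product k x)) =
      - (LINT x:?\<Omega>|lebesgue. (h x \<bullet> e) * sine_cosine_product i k x)"
    using lim2 tendsto_minus[OF lim1] unfolding eq by (rule LIMSEQ_unique)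
  then have "(LINT x:?\<Omega>|lebesgue. real (k i) * (cosine_product k x * w x)) =
      - (LINT x:?\<Omega>|lebesgue. sine_cosine_product i k x * h x $ i)"
    by (simp add: he mult_ac)
  then show ?thesis by simp
qed

section \<open>Cosine products as orthogonal eigenfunctions\<close>
lemma square_integrable_cong:
  assumes "\<And>x. x \<in> \<Omega> \<Longrightarrow> u x = v x"
  shows "square_integrable_on \<Omega> u = square_integrable_on \<Omega> v"
proof -
  have "(\<lambda>x. indicat_real \<Omega> x *\<^sub>R u x) = (\<lambda>x. indicat_real \<Omega> x *\<^sub>R v x)"
    "(\<lambda>x. indicat_real \<Omega> x *\<^sub>R (u x)\<^sup>2) = (\<lambda>x. indicat_real \<Omega> x *\<^sub>R (v x)\<^sup>2)"
    using assms by (auto simp: indicator_def fun_eq_iff)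
  then show ?thesis
    unfolding square_integrable_on_def set_borel_measurable_def set_integrable_def by simp
qed

lemma H1_with_gradient_cong:
  assumes "\<And>x. x \<in> \<Omega> \<Longrightarrow> u x = v x" "\<Omega> \<in> sets lebesgue"
  shows "H1_with_gradient \<Omega> u g = H1_with_gradient \<Omega> v g"
proof -
  have "(LINT x:\<Omega>|lebesgue. u x * f x) = (LINT x:\<Omega>|lebesgue. v x * f x)" for f
    using assms by (intro set_lebesgue_integral_cong) auto
  then show ?thesis
    unfolding H1_with_gradient_def using square_integrable_cong[of \<Omega> u v] assms by simp
qed

lemma H1_inner:
  assumes "H1_with_gradient \<Omega> u g" "H1_with_gradient \<Omega> w h"
  shows "set_integrable lebesgue \<Omega> (\<lambda>x. g x \<bullet> h x)"
    and "(LINT x:\<Omega>|lebesgue. g x \<bullet> h x) =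
      (\<Sum>i\<in>Basis. LINT x:\<Omega>|lebesgue. (g x \<bullet> i) * (h x \<bullet> i))"
proof -
  have i: "integrable lebesgue (\<lambda>x. indicat_real \<Omega> x *\<^sub>R ((g x \<bullet> i) * (h x \<bullet> i)))" if "i \<in> Basis" for i
    using square_integrable_mult[of \<Omega> "\<lambda>x. g x \<bullet> i" "\<lambda>x. h x \<bullet> i"] assms that
    unfolding H1_with_gradient_def set_integrable_def by blast
  have eq: "g x \<bullet> h x = (\<Sum>i\<in>Basis. (g x \<bullet> i) * (h x \<bullet> i))" for x
    by (rule euclidean_inner)
  show "set_integrable lebesgue \<Omega> (\<lambda>x. g x \<bullet> h x)"
    unfolding set_integrable_def eq scaleR_sum_right
    using i by (rule Bochner_Integration.integrable_sum)
  show "(LINT x:\<Omega>|lebesgue. g x \<bullet> h x) =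
      (\<Sum>i\<in>Basis. LINT x:\<Omega>|lebesgue. (g x \<bullet> i) * (h x \<bullet> i))"
    unfolding set_lebesgue_integral_def eq scaleR_sum_right
    using i by (rule Bochner_Integration.integral_sum)
qed

lemma test_function_square_integrable:
  assumes "test_function (hypercube a) \<phi>" "i \<in> Basis"
  shows "square_integrable_on (hypercube a) \<phi>" "square_integrable_on (hypercube a) (partial_deriv i \<phi>)"
  using assms smooth_imp[of \<phi>] by (auto simp: test_function_def intro: square_integrable_continuous)

lemma set_integral_lincomb:
  fixes f g :: "'a \<Rightarrow> real"
  assumes "set_integrable M A f" "set_integrable M A g"
  shows "(LINT x:A|M. a * f x + b * g x) = a * (LINT x:A|M. f x) + b * (LINT x:A|M. g x)"
  using assms by (subst set_integral_add) auto

lemma H1_lincomb: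
  assumes H: "H1_with_gradient (hypercube a) u g" "H1_with_gradient (hypercube a) v h"
  shows "H1_with_gradient (hypercube a) (\<lambda>x. c * u x + d * v x) (\<lambda>x. c *\<^sub>R g x + d *\<^sub>R h x)"
  unfolding H1_with_gradient_def
proof (intro conjI ballI allI impI)
  show "square_integrable_on (hypercube a) (\<lambda>x. c * u x + d * v x)"
    using H unfolding H1_with_gradient_def
    by (intro square_integrable_add square_integrable_cmult) auto
  fix i :: "real ^ 'a" assume i: "i \<in> Basis"
  show "square_integrable_on (hypercube a) (\<lambda>x. (c *\<^sub>R g x + d *\<^sub>R h x) \<bullet> i)"
    using H i unfolding H1_with_gradient_def inner_add_left inner_scaleR_left
    by (intro square_integrable_add square_integrable_cmult) auto
  fix \<phi> :: "real ^ 'a \<Rightarrow> real" assume \<phi>: "test_function (hypercube a) \<phi>"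
  have sq: "square_integrable_on (hypercube a) u" "square_integrable_on (hypercube a) v"
    "square_integrable_on (hypercube a) (\<lambda>x. g x \<bullet> i)" "square_integrable_on (hypercube a) (\<lambda>x. h x \<bullet> i)"
    and eq: "(LINT x:hypercube a|lebesgue. u x * partial_deriv i \<phi> x)
             = - (LINT x:hypercube a|lebesgue. (g x \<bullet> i) * \<phi> x)"
      "(LINT x:hypercube a|lebesgue. v x * partial_deriv i \<phi> x)
             = - (LINT x:hypercube a|lebesgue. (h x \<bullet> i) * \<phi> x)"
    using H i \<phi> unfolding H1_with_gradient_def by blast+
  note test = test_function_square_integrable[OF \<phi> i]
  have "(LINT x:hypercube a|lebesgue. (c * u x + d * v x) * partial_deriv i \<phi> x) =
      c * (LINT x:hypercube a|lebesgue. u x * partial_deriv i \<phi> x) +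
      d * (LINT x:hypercube a|lebesgue. v x * partial_deriv i \<phi> x)"
    unfolding distrib_right mult.assoc
    by (intro set_integral_lincomb square_integrable_mult sq test)
  also have "\<dots> = - (c * (LINT x:hypercube a|lebesgue. (g x \<bullet> i) * \<phi> x) +
      d * (LINT x:hypercube a|lebesgue. (h x \<bullet> i) * \<phi> x))"
    by (simp add: eq)
  also have "\<dots> = - (LINT x:hypercube a|lebesgue. ((c *\<^sub>R g x + d *\<^sub>R h x) \<bullet> i) * \<phi> x)"
    unfolding inner_add_left inner_scaleR_left distrib_right mult.assoc
    by (subst set_integral_lincomb) (auto intro!: square_integrable_mult sq test)
  finally show "(LINT x:hypercube a|lebesgue. (c * u x + d * v x) * partial_deriv i \<phi> x) =
      - (LINT x:hypercube a|lebesgue. ((c *\<^sub>R g x + d *\<^sub>R h x) \<bullet> i) * \<phi> x)" .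
qed

lemma neumann_eigenspace_lincomb:
  assumes "u \<in> neumann_eigenspace (hypercube a) \<mu>" "v \<in> neumann_eigenspace (hypercube a) \<mu>"
  shows "(\<lambda>x. c * u x + d * v x) \<in> neumann_eigenspace (hypercube a) \<mu>"
proof -
  obtain g h where g: "H1_with_gradient (hypercube a) u g" and h: "H1_with_gradient (hypercube a) v h"
    and eq: "\<And>w q. H1_with_gradient (hypercube a) w q \<Longrightarrow>
       (LINT x:hypercube a|lebesgue. g x \<bullet> q x) = \<mu> * (LINT x:hypercube a|lebesgue. u x * w x)"
     "\<And>w q. H1_with_gradient (hypercube a) w q \<Longrightarrow>
       (LINT x:hypercube a|lebesgue. h x \<bullet> q x) = \<mu> * (LINT x:hypercube a|lebesgue. v x * w x)"
    using assms unfolding neumann_eigenspace_def by blast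
  have "(LINT x:hypercube a|lebesgue. (c *\<^sub>R g x + d *\<^sub>R h x) \<bullet> q x) =
      \<mu> * (LINT x:hypercube a|lebesgue. (c * u x + d * v x) * w x)"
    if q: "H1_with_gradient (hypercube a) w q" for w q
  proof -
    have sq: "square_integrable_on (hypercube a) u" "square_integrable_on (hypercube a) v"
      "square_integrable_on (hypercube a) w"
      using g h q unfolding H1_with_gradient_def by auto
    have "(LINT x:hypercube a|lebesgue. (c *\<^sub>R g x + d *\<^sub>R h x) \<bullet> q x) =
        c * (\<mu> * (LINT x:hypercube a|lebesgue. u x * w x)) + d * (\<mu> * (LINT x:hypercube a|lebesgue. v x * w x))"
      unfolding inner_add_left inner_scaleR_left eq[OF q, symmetric]
      by (intro set_integral_lincomb H1_inner(1)[OF g q] H1_inner(1)[OF h q])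
    also have "\<dots> = \<mu> * (LINT x:hypercube a|lebesgue. (c * u x + d * v x) * w x)"
      unfolding distrib_right mult.assoc
      by (subst set_integral_lincomb) (auto intro!: square_integrable_mult sq simp: algebra_simps)
    finally show ?thesis .
  qed
  moreover have "continuous_on (hypercube a) (\<lambda>x. c * u x + d * v x)"
    "\<And>x. x \<notin> hypercube a \<Longrightarrow> c * u x + d * v x = 0"
    using assms by (auto simp: neumann_eigenspace_def intro!: continuous_intros)
  ultimately show ?thesis
    using H1_lincomb[OF g h, of c d] unfolding neumann_eigenspace_def by blast
qed

lemma set_integral_continuous_pos:
  fixes f :: "'a::euclidean_space \<Rightarrow> real"
  assumes "open \<Omega>" "continuous_on \<Omega> f" "set_integrable lebesgue \<Omega> f"
    and nonneg: "\<And>x. x \<in> \<Omega> \<Longrightarrow> 0 \<le> f x" and x: "x \<in> \<Omega>" "0 < f x"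
  shows "0 < (LINT x:\<Omega>|lebesgue. f x)"
proof -
  have "open {y \<in> \<Omega>. f x / 2 < f y}"
    using assms(2) continuous_on_open_vimage[OF assms(1), of f]
    by (auto simp: vimage_def Int_def conj_commute dest: spec[of _ "{f x / 2<..}"])
  then obtain r where r: "r > 0" "ball x r \<subseteq> {y \<in> \<Omega>. f x / 2 < f y}"
    using x by (auto simp: open_contains_ball)
  have "0 < f x / 2 * measure lborel (ball x r)"
    using x r by (simp add: content_ball_pos)
  also have "\<dots> = (\<integral>y. f x / 2 * indicator (ball x r) y \<partial>lebesgue)"
    by (simp add: measure_completion)
  also have "\<dots> \<le> (LINT x:\<Omega>|lebesgue. f x)"
    unfolding set_lebesgue_integral_def
  proof (rule integral_mono)
    show "integrable lebesgue (\<lambda>y. f x / 2 * indicat_real (ball x r) y)"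
      by (intro integrable_mult_right integrable_real_indicator)
        (use emeasure_bounded_finite[of "ball x r"] in auto)
    show "f x / 2 * indicat_real (ball x r) y \<le> indicat_real \<Omega> y *\<^sub>R f y" for y
      using r nonneg[of y] by (force simp: indicator_def)
  qed (use assms in \<open>simp add: set_integrable_def\<close>)
  finally show ?thesis .
qed

definition frequency :: "('n::finite \<Rightarrow> nat) \<Rightarrow> nat" where
  "frequency k = (\<Sum>i\<in>UNIV. (k i)\<^sup>2)"

definition cosine_eigenfunction :: "('n::finite \<Rightarrow> nat) \<Rightarrow> real ^ 'n \<Rightarrow> real" where
  "cosine_eigenfunction k x = (if x \<in> hypercube pi then cosine_product k x else 0)"

lemma Basis_cart: "(Basis :: (real ^ 'n::finite) set) = (\<lambda>i. axis i 1) ` UNIV"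
  by (auto simp: Basis_vec_def)

lemma Green_cosine_product:
  fixes h :: "real ^ 'n::finite \<Rightarrow> real ^ 'n"
  assumes "H1_with_gradient (hypercube pi) w h"
  shows "(LINT x:hypercube pi|lebesgue. cosine_gradient k x \<bullet> h x) =
    real (frequency k) * (LINT x:hypercube pi|lebesgue. cosine_product k x * w x)"
proof -
  have "(LINT x:hypercube pi|lebesgue. cosine_gradient k x \<bullet> h x) =
      (\<Sum>i\<in>UNIV. LINT x:hypercube pi|lebesgue. (- real (k i)) * (sine_cosine_product i k x * h x $ i))"
    unfolding H1_inner(2)[OF H1_cosine_product assms] Basis_cart
    by (subst sum.reindex) (auto intro!: inj_onI simp: axis_eq_axis inner_axis cosine_gradient_def mult.assoc)
  also have "\<dots> = (\<Sum>i\<in>UNIV. (real (k i))\<^sup>2 * (LINT x:hypercube pi|lebesgue. cosine_product k x * w x))"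
    unfolding set_integral_mult_right Green_sine_cosine_product[OF assms]
    by (simp add: power2_eq_square mult.assoc)
  finally show ?thesis
    by (simp add: frequency_def sum_distrib_right)
qed

text \<open>
  Suppose \<open>k i \<noteq> l i\<close>. With \<open>I\<close> the integral in question and \<open>J\<close> the integral of the product of the
  two sine-cosine products, the Green formula in direction \<open>i\<close> for the pairs \<open>(k, l)\<close> and
  \<open>(l, k)\<close> yields \<open>l\<^sub>i J = k\<^sub>i I\<close> and \<open>k\<^sub>i J = l\<^sub>i I\<close>, whence \<open>(k\<^sub>i\<^sup>2 - l\<^sub>i\<^sup>2) I = 0\<close>.
\<close>
lemma cosine_product_orthogonal:
  fixes k l :: "'n::finite \<Rightarrow> nat"
  assumes "k \<noteq> l"
  shows "(LINT x:hypercube pi|lebesgue. cosine_product k x * cosine_product l x) = 0"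
proof -
  define I where "I = (LINT x:hypercube pi|lebesgue. cosine_product k x * cosine_product l x)"
  obtain i where i: "k i \<noteq> l i" using assms by auto
  define J where "J = (LINT x:hypercube pi|lebesgue. sine_cosine_product i k x * sine_cosine_product i l x)"
  have "(LINT x:hypercube pi|lebesgue. sine_cosine_product i k x * cosine_gradient l x $ i) = - real (l i) * J"
    "(LINT x:hypercube pi|lebesgue. sine_cosine_product i l x * cosine_gradient k x $ i) = - real (k i) * J"
    unfolding J_def set_integral_mult_right[symmetric] by (simp_all add: cosine_gradient_def mult_ac)
  then have "real (l i) * J = real (k i) * I" "real (k i) * J = real (l i) * I"
    using Green_sine_cosine_product[OF H1_cosine_product, of i k l]
      Green_sine_cosine_product[OF H1_cosine_product, of i l k]
    by (simp_all add: I_def mult.commute[of "cosine_product l _"])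
  then have "real (k i) * (real (k i) * I) = real (l i) * (real (l i) * I)"
    by (metis mult.left_commute)
  then have "((real (k i))\<^sup>2 - (real (l i))\<^sup>2) * I = 0"
    by (simp add: power2_eq_square algebra_simps)
  moreover have "(real (k i))\<^sup>2 \<noteq> (real (l i))\<^sup>2"
    using i by (simp add: power2_eq_iff_nonneg)
  ultimately show ?thesis by (simp add: I_def)
qed

text \<open>
  At a point of the diagonal close enough to the origin all the arguments \<open>k i * x $ i\<close> are at most 1,
  which makes every cosine positive.
\<close>
lemma cosine_product_near_0:
  "\<exists>x\<in>hypercube pi. 0 < cosine_product k x"
proof -
  define N where "N = (\<Sum>i\<in>UNIV. k i) + 1"
  define x :: "real ^ 'a" where "x = (\<chi> i. 1 / real N)"
  have "cos (real (k i) * (1 / real N)) > 0" for i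
  proof -
    have "k i \<le> N" by (simp add: N_def member_le_sum le_SucI)
    moreover have "N > 0" by (simp add: N_def)
    ultimately have "real (k i) * (1 / real N) \<le> 1" by simp
    moreover have "0 \<le> real (k i) * (1 / real N)" by simp
    ultimately show ?thesis
      using pi_gt3 by (intro cos_gt_zero_pi) linarith+
  qed
  then have "0 < cosine_product k x"
    by (simp add: cosine_product_def tensor_def x_def prod_pos)
  moreover have N: "N \<ge> 1" by (simp add: N_def)
  then have "1 / real N \<le> 1" by simp
  then have "1 / real N < pi"
    using pi_gt3 by linarith
  then have "x \<in> hypercube pi"
    using N by (simp add: hypercube_def x_def)
  ultimately show ?thesis by blast
qed

lemma cosine_product_norm_pos:
  "0 < (LINT x:hypercube pi|lebesgue. cosine_product k x * cosine_product k x)"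
proof -
  obtain x where "x \<in> hypercube pi" "0 < cosine_product k x"
    using cosine_product_near_0 by blast
  then show ?thesis
    by (intro set_integral_continuous_pos[of _ _ x] open_hypercube square_integrable_mult
        square_integrable_continuous continuous_intros continuous_cosine_product) auto
qed

lemma cosine_eigenfunction_in_eigenspace:
  "cosine_eigenfunction k \<in> neumann_eigenspace (hypercube pi) (real (frequency k))"
proof -
  have eq: "cosine_eigenfunction k x = cosine_product k x" if "x \<in> hypercube pi" for x
    using that by (simp add: cosine_eigenfunction_def)
  have "continuous_on (hypercube pi) (cosine_eigenfunction k)"
    using continuous_cosine_product by (rule continuous_on_eq) (simp add: eq)
  moreover have "H1_with_gradient (hypercube pi) (cosine_eigenfunction k) (cosine_gradient k)"
    using H1_cosine_product[of pi k]
      H1_with_gradient_cong[of "hypercube pi" "cosine_eigenfunction k" "cosine_product k"] eq by simp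
  moreover have "(LINT x:hypercube pi|lebesgue. cosine_gradient k x \<bullet> h x) =
      real (frequency k) * (LINT x:hypercube pi|lebesgue. cosine_eigenfunction k x * w x)"
    if "H1_with_gradient (hypercube pi) w h" for w h
  proof -
    have "(LINT x:hypercube pi|lebesgue. cosine_eigenfunction k x * w x) =
        (LINT x:hypercube pi|lebesgue. cosine_product k x * w x)"
      by (intro set_lebesgue_integral_cong) (auto simp: eq)
    with Green_cosine_product[OF that, of k] show ?thesis by simp
  qed
  moreover have "\<forall>x. x \<notin> hypercube pi \<longrightarrow> cosine_eigenfunction k x = 0"
    by (simp add: cosine_eigenfunction_def)
  ultimately show ?thesis
    unfolding neumann_eigenspace_def by blast
qed

text \<open>The symmetry of the Dirichlet form: both sides of it are evaluated by an eigenvalue equation.\<close>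
lemma eigenspace_orthogonal:
  assumes "u \<in> neumann_eigenspace (hypercube pi) \<mu>" "\<mu> \<noteq> real (frequency k)"
  shows "(LINT x:hypercube pi|lebesgue. u x * cosine_product k x) = 0"
proof -
  obtain g where g: "H1_with_gradient (hypercube pi) u g"
    and eq: "\<And>w h. H1_with_gradient (hypercube pi) w h \<Longrightarrow>
       (LINT x:hypercube pi|lebesgue. g x \<bullet> h x) = \<mu> * (LINT x:hypercube pi|lebesgue. u x * w x)"
    using assms unfolding neumann_eigenspace_def by blast
  have "real (frequency k) * (LINT x:hypercube pi|lebesgue. u x * cosine_product k x) =
      \<mu> * (LINT x:hypercube pi|lebesgue. u x * cosine_product k x)"
    using eq[OF H1_cosine_product, of k] Green_cosine_product[OF g, of k]
    by (simp add: inner_commute[of "g _"] mult.commute[of "u _"])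
  then show ?thesis using assms by simp
qed

section \<open>Completeness of the cosine products\<close>

text \<open>
  The addition theorem \<open>2 cos t cos (n t) = cos ((n+1) t) + cos ((n-1) t)\<close>; for \<open>n = 0\<close> the
  frequency \<open>-1\<close> is replaced by 1.
\<close>
lemma cos_mult_cosine_product:
  "(\<lambda>x. cos (x $ i) * cosine_product k x) = (1/2) *\<^sub>R
     (cosine_product (k(i := k i + 1)) + cosine_product (k(i := if k i = 0 then 1 else k i - 1)))"
proof
  fix x :: "real ^ 'a"
  let ?P = "\<Prod>j\<in>UNIV - {i}. cos (real (k j) * x $ j)"
  have upd: "cosine_product (k(i := m)) x = cos (real m * x $ i) * ?P" for m
    unfolding cosine_product_def tensor_def
    by (subst prod.remove[of _ i]) (auto intro!: prod.cong)
  have c: "cos t * cos (real n * t) =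
      (cos (real (n + 1) * t) + cos (real (if n = 0 then 1 else n - 1) * t)) / 2" for n and t :: real
    by (cases n) (auto simp: cos_times_cos algebra_simps)
  have "cos (x $ i) * cosine_product k x = (cos (x $ i) * cos (real (k i) * x $ i)) * ?P"
    using upd[of "k i"] by (simp add: mult.assoc)
  also have "\<dots> = (1/2) * (cosine_product (k(i := k i + 1)) x +
      cosine_product (k(i := if k i = 0 then 1 else k i - 1)) x)"
    unfolding c upd by (simp add: algebra_simps)
  finally show "cos (x $ i) * cosine_product k x = ((1/2) *\<^sub>R (cosine_product (k(i := k i + 1)) +
      cosine_product (k(i := if k i = 0 then 1 else k i - 1)))) x"
    by (simp add: scaleR_fun_def)
qed

definition cosine_span :: "(real ^ 'n::finite \<Rightarrow> real) set" where
  "cosine_span = span (range cosine_product)"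

text \<open>
  That the span of the cosine products is closed under multiplication would require the expansion of a
  general product of two of them. The ring of multipliers of the span is an algebra by
  construction and needs only the products with a single cosine; since the span contains 1, the
  multipliers belong to it.
\<close>
definition cosine_multipliers :: "(real ^ 'n::finite \<Rightarrow> real) set" where
  "cosine_multipliers = {f. \<forall>g\<in>cosine_span. (\<lambda>x. f x * g x) \<in> cosine_span}"

lemma cosine_product_0: "cosine_product (\<lambda>_. 0) x = 1"
  by (simp add: cosine_product_def tensor_def)

lemma cosine_multipliers_subset_span: "cosine_multipliers \<subseteq> cosine_span"
proof
  fix f :: "real ^ 'n \<Rightarrow> real" assume "f \<in> cosine_multipliers"
  moreover have "cosine_product (\<lambda>_. 0) \<in> cosine_span"
    unfolding cosine_span_def by (rule span_base) simp
  ultimately have "(\<lambda>x. f x * cosine_product (\<lambda>_. 0) x) \<in> cosine_span"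
    unfolding cosine_multipliers_def by blast
  then show "f \<in> cosine_span"
    by (simp add: cosine_product_0)
qed

lemma cosine_span_continuous:
  assumes "f \<in> cosine_span" shows "continuous_on UNIV f"
  using assms unfolding cosine_span_def
proof (induction rule: span_induct)
  case base
  show ?case
    by (auto simp: subspace_def plus_fun_def scaleR_fun_def zero_fun_def intro!: continuous_intros)
qed (auto intro: continuous_cosine_product)

lemma cos_in_multipliers: "(\<lambda>x. cos (x $ i)) \<in> cosine_multipliers"
  unfolding cosine_multipliers_def
proof (intro CollectI ballI)
  fix g :: "real ^ 'a \<Rightarrow> real" assume "g \<in> cosine_span"
  then show "(\<lambda>x. cos (x $ i) * g x) \<in> cosine_span"
    unfolding cosine_span_def
  proof (induction rule: span_induct)
    case base
    let ?m = "\<lambda>f x. cos (x $ i) * f x"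
    have m: "?m 0 = 0" "?m (f + g) = ?m f + ?m g" "?m (c *\<^sub>R f) = c *\<^sub>R ?m f"
      for f g :: "real ^ 'a \<Rightarrow> real" and c
      by (auto simp: plus_fun_def scaleR_fun_def zero_fun_def algebra_simps)
    show ?case
      by (rule subspaceI; unfold mem_Collect_eq m) (auto intro: span_zero span_add span_scale)
  next
    case (step f)
    then obtain k where "f = cosine_product k" by auto
    then show ?case
      unfolding cos_mult_cosine_product[of i k] by (simp add: cos_mult_cosine_product span_add span_scale span_base)
  qed
qed

lemma function_ring_cosine_multipliers:
  "function_ring_on cosine_multipliers (closure (hypercube pi))"
proof
  show "compact (closure (hypercube pi))"
    by (simp add: compact_closure bounded_hypercube)
  show "continuous_on (closure (hypercube pi)) f" if "f \<in> cosine_multipliers" for f :: "real ^ 'a \<Rightarrow> real"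
    using that cosine_multipliers_subset_span cosine_span_continuous continuous_on_subset by blast
  fix f g :: "real ^ 'a \<Rightarrow> real" assume fg: "f \<in> cosine_multipliers" "g \<in> cosine_multipliers"
  show "(\<lambda>x. f x + g x) \<in> cosine_multipliers"
    unfolding cosine_multipliers_def
  proof (intro CollectI ballI)
    fix h :: "real ^ 'a \<Rightarrow> real" assume "h \<in> cosine_span"
    then have "(\<lambda>x. f x * h x) + (\<lambda>x. g x * h x) \<in> cosine_span"
      using fg unfolding cosine_multipliers_def cosine_span_def by (intro span_add) auto
    then show "(\<lambda>x. (f x + g x) * h x) \<in> cosine_span"
      by (simp add: plus_fun_def algebra_simps)
  qed
  show "(\<lambda>x. f x * g x) \<in> cosine_multipliers"
    using fg unfolding cosine_multipliers_def by (auto simp: mult.assoc)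
next
  fix c :: real
  show "(\<lambda>_. c) \<in> (cosine_multipliers :: (real ^ 'a \<Rightarrow> real) set)"
    unfolding cosine_multipliers_def cosine_span_def
    using span_scale[of _ "range cosine_product" c] unfolding scaleR_fun_def real_scaleR_def by blast
next
  fix x y :: "real ^ 'a" assume xy: "x \<in> closure (hypercube pi)" "y \<in> closure (hypercube pi)" "x \<noteq> y"
  have "hypercube pi \<subseteq> cbox 0 (\<chi> i::'a. pi)"
    unfolding hypercube_eq_box by (rule box_subset_cbox)
  then have "closure (hypercube pi) \<subseteq> cbox 0 (\<chi> i::'a. pi)"
    by (intro closure_minimal) auto
  then have c: "x \<in> cbox 0 (\<chi> i::'a. pi)" "y \<in> cbox 0 (\<chi> i::'a. pi)"
    using xy by auto
  obtain i where "x $ i \<noteq> y $ i"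
    using xy(3) by (auto simp: vec_eq_iff)
  then have "cos (x $ i) \<noteq> cos (y $ i)"
    using c cos_inj_pi[of "x $ i" "y $ i"] by (auto simp: mem_box_cart)
  then show "\<exists>f\<in>cosine_multipliers. f x \<noteq> f y"
    by (intro bexI[OF _ cos_in_multipliers[of i]])
qed

lemma cosine_span_orthogonal:
  assumes u: "square_integrable_on (hypercube pi) u"
    and orth: "\<And>k. (LINT x:hypercube pi|lebesgue. u x * cosine_product k x) = 0"
    and f: "f \<in> cosine_span"
  shows "(LINT x:hypercube pi|lebesgue. u x * f x) = 0"
proof -
  have "continuous_on UNIV f \<and> (LINT x:hypercube pi|lebesgue. u x * f x) = 0"
    using f unfolding cosine_span_def
  proof (induction rule: span_induct)
    case base
    have "(LINT x:hypercube pi|lebesgue. u x * (f x + g x)) =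
        (LINT x:hypercube pi|lebesgue. u x * f x) + (LINT x:hypercube pi|lebesgue. u x * g x)"
      if "continuous_on UNIV f" "continuous_on UNIV g" for f g
      unfolding distrib_left
      by (intro set_integral_add square_integrable_mult u square_integrable_continuous that)
    then show ?case
      by (auto simp: subspace_def plus_fun_def scaleR_fun_def zero_fun_def mult.left_commute[of "u _"]
          intro!: continuous_intros)
  qed (auto simp: orth intro: continuous_cosine_product)
  then show ?thesis ..
qed

lemma cosine_product_complete_weak:
  fixes \<psi> :: "real ^ 'n::finite \<Rightarrow> real"
  assumes u: "square_integrable_on (hypercube pi) u"
    and orth: "\<And>k. (LINT x:hypercube pi|lebesgue. u x * cosine_product k x) = 0"
    and \<psi>: "continuous_on UNIV \<psi>"
  shows "(LINT x:hypercube pi|lebesgue. u x * \<psi> x) = 0"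
proof -
  let ?\<Omega> = "hypercube pi :: (real ^ 'n) set"
  define K where "K = (LINT x:?\<Omega>|lebesgue. \<bar>u x\<bar>)"
  have ui: "set_integrable lebesgue ?\<Omega> u"
    using u by (intro square_integrable_imp_set_integrable open_hypercube bounded_hypercube)
  then have ui': "integrable lebesgue (\<lambda>x. indicat_real ?\<Omega> x *\<^sub>R \<bar>u x\<bar>)"
    using set_integrable_abs unfolding set_integrable_def by blast
  have bound: "\<bar>LINT x:?\<Omega>|lebesgue. u x * \<psi> x\<bar> \<le> e * K" if "e > 0" for e
  proof -
    have "\<exists>g\<in>cosine_multipliers. \<forall>x\<in>closure ?\<Omega>. \<bar>\<psi> x - g x\<bar> < e"
      using function_ring_on.Stone_Weierstrass_basic[OF function_ring_cosine_multipliers _ that]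
        continuous_on_subset[OF \<psi>] by blast
    then obtain g where g: "g \<in> cosine_span" "\<And>x. x \<in> ?\<Omega> \<Longrightarrow> \<bar>\<psi> x - g x\<bar> < e"
      using cosine_multipliers_subset_span closure_subset by blast
    have i: "set_integrable lebesgue ?\<Omega> (\<lambda>x. u x * \<psi> x)" "set_integrable lebesgue ?\<Omega> (\<lambda>x. u x * g x)"
      by (intro square_integrable_mult u square_integrable_continuous \<psi> cosine_span_continuous g)+
    have "(LINT x:?\<Omega>|lebesgue. u x * \<psi> x) = (LINT x:?\<Omega>|lebesgue. u x * \<psi> x - u x * g x)"
      using cosine_span_orthogonal[OF u orth g(1)] i by (simp add: set_integral_diff)
    also have "\<bar>\<dots>\<bar> \<le> (LINT x|lebesgue. e * (indicat_real ?\<Omega> x *\<^sub>R \<bar>u x\<bar>))"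
      unfolding set_lebesgue_integral_def real_norm_def[symmetric]
    proof (rule Bochner_Integration.integral_norm_bound_integral)
      show "integrable lebesgue (\<lambda>x. indicat_real ?\<Omega> x *\<^sub>R (u x * \<psi> x - u x * g x))"
        using set_integral_diff(1)[OF i] by (simp add: set_integrable_def)
      show "integrable lebesgue (\<lambda>x. e * (indicat_real ?\<Omega> x *\<^sub>R norm (u x)))"
        using ui' by simp
      show "norm (indicat_real ?\<Omega> x *\<^sub>R (u x * \<psi> x - u x * g x)) \<le> e * (indicat_real ?\<Omega> x *\<^sub>R norm (u x))" for x
      proof (cases "x \<in> ?\<Omega>")
        case True
        have "\<bar>u x\<bar> * \<bar>\<psi> x - g x\<bar> \<le> \<bar>u x\<bar> * e"
          using g(2)[OF True] by (intro mult_left_mono) auto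
        moreover have "u x * \<psi> x - u x * g x = u x * (\<psi> x - g x)"
          by (simp add: right_diff_distrib)
        ultimately show ?thesis
          using True by (simp only: real_norm_def abs_mult) (simp add: abs_mult mult.commute)
      qed simp
    qed
    also have "\<dots> = e * K"
      by (simp add: K_def set_lebesgue_integral_def)
    finally show ?thesis .
  qed
  have "0 \<le> K"
    using bound[of 1] by simp
  have "\<bar>LINT x:?\<Omega>|lebesgue. u x * \<psi> x\<bar> \<le> 0"
  proof (rule field_le_epsilon)
    fix e :: real assume "e > 0"
    then have "e / (K + 1) > 0" using \<open>0 \<le> K\<close> by simp
    from bound[OF this] have "\<bar>LINT x:?\<Omega>|lebesgue. u x * \<psi> x\<bar> \<le> e * (K / (K + 1))" by simp
    also have "\<dots> \<le> e * 1"
      using \<open>0 \<le> K\<close> \<open>e > 0\<close> by (intro mult_left_mono) auto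
    finally show "\<bar>LINT x:?\<Omega>|lebesgue. u x * \<psi> x\<bar> \<le> 0 + e" by simp
  qed
  then show ?thesis by simp
qed

text \<open>
  If \<open>u x \<noteq> 0\<close>, then \<open>u x * u y\<close> is positive for \<open>y\<close> in a ball around \<open>x\<close>, and a tent function
  supported in this ball has a nonzero integral against \<open>u\<close>.
\<close>
lemma cosine_product_complete:
  fixes u :: "real ^ 'n::finite \<Rightarrow> real"
  assumes u: "square_integrable_on (hypercube pi) u" "continuous_on (hypercube pi) u"
    and orth: "\<And>k. (LINT x:hypercube pi|lebesgue. u x * cosine_product k x) = 0"
    and x: "x \<in> hypercube pi"
  shows "u x = 0"
proof (rule ccontr)
  assume ux: "u x \<noteq> 0"
  let ?\<Omega> = "hypercube pi :: (real ^ 'n) set"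
  have "open (?\<Omega> \<inter> (\<lambda>y. u x * u y) -` {0<..})"
    using continuous_on_open_vimage[OF open_hypercube, of pi "\<lambda>y. u x * u y"] u(2)
    by (auto simp: Int_commute intro!: continuous_intros)
  then obtain r where r: "r > 0" "ball x r \<subseteq> ?\<Omega> \<inter> (\<lambda>y. u x * u y) -` {0<..}"
    using x ux by (force simp: open_contains_ball zero_less_mult_iff)
  define \<psi> where "\<psi> y = max 0 (r - dist x y)" for y
  have \<psi>: "continuous_on A \<psi>" for A
    unfolding \<psi>_def by (intro continuous_intros)
  have "0 < (LINT y:?\<Omega>|lebesgue. u x * (u y * \<psi> y))"
  proof (rule set_integral_continuous_pos[OF open_hypercube _ _ _ x])
    show "continuous_on ?\<Omega> (\<lambda>y. u x * (u y * \<psi> y))"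
      by (intro continuous_intros u \<psi>)
    show "set_integrable lebesgue ?\<Omega> (\<lambda>y. u x * (u y * \<psi> y))"
      by (intro set_integrable_mult_right square_integrable_mult u square_integrable_continuous \<psi>)
    show "0 \<le> u x * (u y * \<psi> y)" for y
    proof (cases "dist x y < r")
      case True
      then have "0 < u x * u y" using r by auto
      then show ?thesis by (simp add: \<psi>_def mult.assoc[symmetric])
    qed (simp add: \<psi>_def)
    show "0 < u x * (u x * \<psi> x)"
      using ux r by (simp add: \<psi>_def mult.assoc[symmetric] zero_less_mult_iff) linarith
  qed
  also have "\<dots> = u x * (LINT y:?\<Omega>|lebesgue. u y * \<psi> y)" by simp
  also have "\<dots> = 0"
    using cosine_product_complete_weak[OF u(1) orth \<psi>] by simp
  finally show False by simp
qed

lemma sum_fun_apply: "(\<Sum>k\<in>K. f k) x = (\<Sum>k\<in>K. f k x)"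
  by (induction K rule: infinite_finite_induct) auto

lemma cosine_eigenfunction_coefficient:
  assumes "finite K"
  shows "(LINT x:hypercube pi|lebesgue. (\<Sum>k\<in>K. c k *\<^sub>R cosine_eigenfunction k) x * cosine_product l x) =
    (if l \<in> K then c l * (LINT x:hypercube pi|lebesgue. cosine_product l x * cosine_product l x) else 0)"
proof -
  have i: "integrable lebesgue (\<lambda>x. indicat_real (hypercube pi) x *\<^sub>R (c k * (cosine_product k x * cosine_product l x)))" for k
    unfolding set_integrable_def[symmetric]
    by (intro set_integrable_mult_right square_integrable_mult square_integrable_continuous
        continuous_cosine_product)
  have "(LINT x:hypercube pi|lebesgue. (\<Sum>k\<in>K. c k *\<^sub>R cosine_eigenfunction k) x * cosine_product l x) =
      (LINT x:hypercube pi|lebesgue. \<Sum>k\<in>K. c k * (cosine_product k x * cosine_product l x))"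
    by (intro set_lebesgue_integral_cong)
      (auto simp: sum_fun_apply scaleR_fun_def cosine_eigenfunction_def sum_distrib_right mult.assoc)
  also have "\<dots> = (\<Sum>k\<in>K. LINT x:hypercube pi|lebesgue. c k * (cosine_product k x * cosine_product l x))"
    unfolding set_lebesgue_integral_def scaleR_sum_right using i by (rule Bochner_Integration.integral_sum)
  also have "\<dots> = (\<Sum>k\<in>K. if k = l then c l * (LINT x:hypercube pi|lebesgue. cosine_product l x * cosine_product l x) else 0)"
    by (intro sum.cong) (auto simp: cosine_product_orthogonal)
  finally show ?thesis using assms by simp
qed

lemma inj_cosine_eigenfunction: "inj cosine_eigenfunction"
proof (rule injI, rule ccontr)
  fix k l :: "'a \<Rightarrow> nat"
  assume eq: "cosine_eigenfunction k = cosine_eigenfunction l" and "k \<noteq> l"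
  then show False
    using cosine_eigenfunction_coefficient[of "{k}" "\<lambda>_. 1" l]
      cosine_eigenfunction_coefficient[of "{l}" "\<lambda>_. 1" l] cosine_product_norm_pos[of l] by simp
qed

lemma independent_cosine_eigenfunctions:
  assumes "finite K" shows "independent (cosine_eigenfunction ` K)"
proof
  assume "dependent (cosine_eigenfunction ` K)"
  then obtain c l where l: "l \<in> K" "c (cosine_eigenfunction l) \<noteq> 0"
    and "(\<Sum>v\<in>cosine_eigenfunction ` K. c v *\<^sub>R v) = 0"
    using assms by (auto simp: dependent_finite)
  then have "(\<Sum>k\<in>K. c (cosine_eigenfunction k) *\<^sub>R cosine_eigenfunction k) = 0"
    by (subst (asm) sum.reindex) (auto intro: inj_on_subset[OF inj_cosine_eigenfunction])
  with cosine_eigenfunction_coefficient[OF assms, of "\<lambda>k. c (cosine_eigenfunction k)" l] l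
    cosine_product_norm_pos[of l]
  show False by simp
qed

lemma finite_frequency_le: "finite {k :: 'n::finite \<Rightarrow> nat. frequency k \<le> m}"
proof (rule finite_subset)
  have "k i \<le> m" if "frequency k \<le> m" for k :: "'n \<Rightarrow> nat" and i
  proof -
    have "k i \<le> (k i)\<^sup>2" by (simp add: power2_eq_square)
    also have "\<dots> \<le> frequency k" unfolding frequency_def by (rule member_le_sum) auto
    finally show ?thesis using that by simp
  qed
  then show "{k :: 'n \<Rightarrow> nat. frequency k \<le> m} \<subseteq> PiE UNIV (\<lambda>_. {..m})"
    by (auto simp: PiE_UNIV_domain)
  show "finite (PiE (UNIV :: 'n set) (\<lambda>_. {..m}))"
    by (rule finite_PiE) auto
qed

lemma finite_frequency_eq: "finite {k :: 'n::finite \<Rightarrow> nat. real (frequency k) = \<mu>}"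
  by (rule finite_subset[OF _ finite_frequency_le[of "nat \<lceil>\<mu>\<rceil>"]]) auto

lemma subspace_neumann_eigenspace: "subspace (neumann_eigenspace (hypercube a) \<mu>)"
proof -
  have "H1_with_gradient (hypercube a) (\<lambda>x. 0) (\<lambda>x. 0)"
    using H1_lincomb[OF H1_cosine_product H1_cosine_product, of a 0 _ 0] by simp
  then have "(\<lambda>x. 0) \<in> neumann_eigenspace (hypercube a) \<mu>"
    unfolding neumann_eigenspace_def by (auto intro!: exI[of _ "\<lambda>x. 0"])
  then show ?thesis
    using neumann_eigenspace_lincomb[of _ a \<mu> _ 1 1] neumann_eigenspace_lincomb[of _ a \<mu> _ _ 0]
    by (auto simp: subspace_def zero_fun_def plus_fun_def scaleR_fun_def)
qed

text \<open>
  Subtracting from an eigenfunction its Fourier part \<open>v\<close> over all \<open>k\<close> of frequency \<open>\<mu>\<close> leaves an element of the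
  eigenspace orthogonal to these cosine products. It is orthogonal to the others because they have
  different eigenvalues, so it vanishes by completeness.
\<close>
theorem neumann_eigenspace_eq_span:
  "neumann_eigenspace (hypercube pi) \<mu> =
    span (cosine_eigenfunction ` {k :: 'n::finite \<Rightarrow> nat. real (frequency k) = \<mu>})"
proof
  let ?K = "{k :: 'n::finite \<Rightarrow> nat. real (frequency k) = \<mu>}"
  let ?\<Omega> = "hypercube pi :: (real ^ 'n) set"
  show sub: "span (cosine_eigenfunction ` ?K) \<subseteq> neumann_eigenspace ?\<Omega> \<mu>"
    using cosine_eigenfunction_in_eigenspace by (intro span_minimal subspace_neumann_eigenspace) auto
  show "neumann_eigenspace ?\<Omega> \<mu> \<subseteq> span (cosine_eigenfunction ` ?K)"
  proof
    fix u assume u: "u \<in> neumann_eigenspace ?\<Omega> \<mu>"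
    define c where "c k = (LINT x:?\<Omega>|lebesgue. u x * cosine_product k x) /
      (LINT x:?\<Omega>|lebesgue. cosine_product k x * cosine_product k x)" for k
    define v where "v = (\<Sum>k\<in>?K. c k *\<^sub>R cosine_eigenfunction k)"
    have v: "v \<in> span (cosine_eigenfunction ` ?K)"
      unfolding v_def by (intro span_sum span_scale span_base) auto
    define w where "w = u - v"
    have w: "w \<in> neumann_eigenspace ?\<Omega> \<mu>"
      unfolding w_def using u v sub by (intro subspace_diff subspace_neumann_eigenspace) auto
    have sq: "square_integrable_on ?\<Omega> f" if "f \<in> neumann_eigenspace ?\<Omega> \<mu>" for f
      using that by (auto simp: neumann_eigenspace_def H1_with_gradient_def)
    have "(LINT x:?\<Omega>|lebesgue. w x * cosine_product l x) = 0" for l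
    proof (cases "l \<in> ?K")
      case True
      have "(LINT x:?\<Omega>|lebesgue. w x * cosine_product l x) =
          (LINT x:?\<Omega>|lebesgue. u x * cosine_product l x) - (LINT x:?\<Omega>|lebesgue. v x * cosine_product l x)"
        unfolding w_def fun_diff_def left_diff_distrib
        using u v sub
        by (intro set_integral_diff square_integrable_mult sq square_integrable_continuous
            continuous_cosine_product) auto
      also have "\<dots> = 0"
        unfolding v_def cosine_eigenfunction_coefficient[OF finite_frequency_eq]
        using True cosine_product_norm_pos[of l] by (simp add: c_def)
      finally show ?thesis .
    qed (use eigenspace_orthogonal[OF w, of l] in auto)
    then have "w x = 0" if "x \<in> ?\<Omega>" for x
      using w that cosine_product_complete[OF sq[OF w]] by (simp add: neumann_eigenspace_def)
    moreover have "w x = 0" if "x \<notin> ?\<Omega>" for x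
      using w that by (simp add: neumann_eigenspace_def)
    ultimately have "w = 0" by (auto simp: fun_eq_iff)
    then show "u \<in> span (cosine_eigenfunction ` ?K)"
      using v by (simp add: w_def)
  qed
qed

section \<open>The listing of the eigenvalues\<close>
lemma infinite_frequencies: "\<exists>m. j \<le> card {k :: 'n::finite \<Rightarrow> nat. frequency k \<le> m}"
proof -
  have "infinite (range (\<lambda>m (_ :: 'n). m :: nat))"
    by (intro range_inj_infinite injI) (auto simp: fun_eq_iff)
  then have "infinite (UNIV :: ('n \<Rightarrow> nat) set)"
    by (rule infinite_super[OF subset_UNIV])
  then obtain S :: "('n \<Rightarrow> nat) set" where S: "finite S" "card S = j"
    using infinite_arbitrarily_large by blast
  have "S \<subseteq> {k. frequency k \<le> (\<Sum>k\<in>S. frequency k)}"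
    using S(1) by (auto intro: member_le_sum)
  then have "j \<le> card {k :: 'n \<Rightarrow> nat. frequency k \<le> (\<Sum>k\<in>S. frequency k)}"
    using card_mono[OF finite_frequency_le[of "\<Sum>k\<in>S. frequency k"], of S] S(2) by simp
  then show ?thesis ..
qed

text \<open>
  The \<open>j\<close>-th eigenvalue \<open>L j\<close> is the least \<open>m\<close> whose sublevel set contains at least \<open>j\<close> multi-indices.
  The indices with \<open>L j = m\<close> then form an interval whose length is the number of \<open>k\<close> with
  \<open>frequency k = m\<close>, so no enumeration of the multi-indices has to be chosen.
\<close>
lemma neumann_listing_hypercube_exists:
  "\<exists>\<Lambda>. neumann_listing (hypercube pi :: (real ^ 'n::finite) set) \<Lambda>"
proof -
  define N where "N m = card {k :: 'n \<Rightarrow> nat. frequency k \<le> m}" for m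
  define L where "L j = (LEAST m. j \<le> N m)" for j
  have N: "j \<le> N (L j)" for j
    unfolding L_def N_def using infinite_frequencies by (rule LeastI_ex)
  have L_le: "L j \<le> m" if "j \<le> N m" for j m
    unfolding L_def using that by (rule Least_le)
  have Nmono: "N m \<le> N m'" if "m \<le> m'" for m m'
    unfolding N_def using that by (intro card_mono finite_frequency_le) auto
  have L_iff: "L j \<le> m \<longleftrightarrow> j \<le> N m" for j m
    using L_le N Nmono order.trans by blast
  have card_fibre: "card {j. 1 \<le> j \<and> L j = m} = card {k :: 'n \<Rightarrow> nat. frequency k = m}"
    and fin_fibre: "finite {j. 1 \<le> j \<and> L j = m}" for m
  proof -
    \<comment> \<open>The interval of indices with value \<open>m\<close> starts after the \<open>M\<close> indices with smaller values.\<close>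
    define M where "M = card {k :: 'n \<Rightarrow> nat. frequency k < m}"
    have M: "L j < m \<longleftrightarrow> j \<le> M" if "1 \<le> j" for j
    proof (cases m)
      case 0
      with that show ?thesis by (simp add: M_def)
    next
      case (Suc m')
      then have "M = N m'" by (simp add: M_def N_def less_Suc_eq_le)
      with Suc L_iff[of j m'] show ?thesis by (simp add: less_Suc_eq_le)
    qed
    have "{j. 1 \<le> j \<and> L j = m} = {M<..N m}"
    proof (intro set_eqI iffI)
      fix j assume "j \<in> {j. 1 \<le> j \<and> L j = m}"
      then show "j \<in> {M<..N m}" using M[of j] L_iff[of j m] by auto
    next
      fix j assume j: "j \<in> {M<..N m}"
      then have "1 \<le> j" by auto
      with j show "j \<in> {j. 1 \<le> j \<and> L j = m}" using M[of j] L_iff[of j m] by auto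
    qed
    moreover have "N m = M + card {k :: 'n \<Rightarrow> nat. frequency k = m}"
    proof -
      have "{k :: 'n \<Rightarrow> nat. frequency k \<le> m} = {k. frequency k < m} \<union> {k. frequency k = m}"
        by auto
      moreover have "finite {k :: 'n \<Rightarrow> nat. frequency k < m}" "finite {k :: 'n \<Rightarrow> nat. frequency k = m}"
        by (rule finite_subset[OF _ finite_frequency_le[of m]], force)+
      ultimately show ?thesis
        unfolding N_def M_def by (simp add: card_Un_disjoint disjoint_iff)
    qed
    ultimately show "card {j. 1 \<le> j \<and> L j = m} = card {k :: 'n \<Rightarrow> nat. frequency k = m}"
      "finite {j. 1 \<le> j \<and> L j = m}" by simp_all
  qed
  have "mono_on {1..} (\<lambda>j. real (L j))"
  proof (rule mono_onI)
    fix i j :: nat assume "i \<le> j"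
    then have "i \<le> N (L j)" using N[of j] by simp
    then show "real (L i) \<le> real (L j)" by (simp add: L_le)
  qed
  moreover have "\<exists>B b. independent B \<and> span B = neumann_eigenspace (hypercube pi :: (real ^ 'n) set) \<mu> \<and>
      bij_betw b {j. 1 \<le> j \<and> real (L j) = \<mu>} B" for \<mu>
  proof -
    let ?K = "{k :: 'n \<Rightarrow> nat. real (frequency k) = \<mu>}"
    have "card {j. 1 \<le> j \<and> real (L j) = \<mu>} = card ?K \<and> finite {j. 1 \<le> j \<and> real (L j) = \<mu>}"
    proof (cases "\<mu> \<in> \<nat>")
      case True
      then obtain m where "\<mu> = real m" by (auto elim: Nats_cases)
      then show ?thesis using card_fibre[of m] fin_fibre[of m] by simp
    next
      case False
      then have "real m \<noteq> \<mu>" for m by auto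
      then show ?thesis by simp
    qed
    moreover have "card (cosine_eigenfunction ` ?K) = card ?K"
      by (intro card_image inj_on_subset[OF inj_cosine_eigenfunction]) auto
    ultimately have "\<exists>b. bij_betw b {j. 1 \<le> j \<and> real (L j) = \<mu>} (cosine_eigenfunction ` ?K)"
      by (intro finite_same_card_bij) (auto simp: finite_frequency_eq)
    then obtain b where "bij_betw b {j. 1 \<le> j \<and> real (L j) = \<mu>} (cosine_eigenfunction ` ?K)" ..
    then show ?thesis
      using independent_cosine_eigenfunctions[OF finite_frequency_eq] neumann_eigenspace_eq_span[symmetric]
      by (intro exI[of _ "cosine_eigenfunction ` ?K"] exI[of _ b] conjI)
  qed
  ultimately show ?thesis
    unfolding neumann_listing_def by (intro exI[of _ "\<lambda>j. real (L j)"] conjI allI)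
qed

lemma neumann_listing_eigenvalue:
  "neumann_listing (hypercube pi :: (real ^ 'n::finite) set)
     (neumann_eigenvalue (hypercube pi :: (real ^ 'n) set))"
  unfolding neumann_eigenvalue_def using neumann_listing_hypercube_exists by (rule someI_ex)

text \<open>Any two bases of an eigenspace have the same cardinality, so the choice of the listing is immaterial.\<close>
lemma neumann_eigenvalue_multiplicity:
  fixes \<mu> :: real
  defines "J \<equiv> {j. 1 \<le> j \<and> neumann_eigenvalue (hypercube pi :: (real ^ 'n::finite) set) j = \<mu>}"
  shows "finite J" "card J = card {k :: 'n \<Rightarrow> nat. real (frequency k) = \<mu>}"
proof -
  let ?K = "{k :: 'n \<Rightarrow> nat. real (frequency k) = \<mu>}"
  obtain B b where B: "independent B" "span B = neumann_eigenspace (hypercube pi :: (real ^ 'n) set) \<mu>"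
    and b: "bij_betw b J B"
    using neumann_listing_eigenvalue unfolding neumann_listing_def J_def by blast
  have sp: "span B = span (cosine_eigenfunction ` ?K)"
    unfolding B(2) neumann_eigenspace_eq_span ..
  have fin: "finite (cosine_eigenfunction ` ?K)"
    by (intro finite_imageI finite_frequency_eq)
  have "finite B"
    using independent_span_bound[OF fin B(1)] sp span_superset by blast
  with b show "finite J" by (simp add: bij_betw_finite)
  have "card J = card B" using b by (rule bij_betw_same_card)
  also have "\<dots> = card (cosine_eigenfunction ` ?K)"
    using sp B(1) independent_cosine_eigenfunctions[OF finite_frequency_eq]
    by (metis dim_span_eq_card_independent)
  also have "\<dots> = card ?K"
    by (intro card_image inj_on_subset[OF inj_cosine_eigenfunction]) auto
  finally show "card J = card ?K" .
qed

text \<open>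
  A multi-index of frequency below 4 has entries 0 and 1 only, hence is determined by the set of its
  ones. The full set is not attained since its frequency is \<open>n \<ge> 4\<close>.
\<close>
lemma card_frequency_less_4:
  assumes "CARD('n::finite) \<ge> 4"
  shows "card {k :: 'n \<Rightarrow> nat. frequency k < 4} < 2 ^ CARD('n)"
proof -
  let ?K = "{k :: 'n \<Rightarrow> nat. frequency k < 4}"
  have le1: "k i \<le> 1" if "k \<in> ?K" for k i
  proof (rule ccontr)
    assume "\<not> k i \<le> 1"
    then have "2\<^sup>2 \<le> (k i)\<^sup>2" by (intro power_mono) auto
    also have "\<dots> \<le> frequency k" unfolding frequency_def by (rule member_le_sum) auto
    finally show False using that by simp
  qed
  have "inj_on (\<lambda>k. {i. k i = 1}) ?K"
  proof (rule inj_onI)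
    fix k l assume kl: "k \<in> ?K" "l \<in> ?K" "{i. k i = 1} = {i. l i = 1}"
    show "k = l"
    proof
      fix i
      have "k i = 1 \<longleftrightarrow> l i = 1" using kl(3) by (auto simp: set_eq_iff)
      then show "k i = l i" using le1[OF kl(1), of i] le1[OF kl(2), of i] by linarith
    qed
  qed
  moreover have "(\<lambda>k. {i. k i = 1}) ` ?K \<subseteq> Pow UNIV - {UNIV}"
  proof (intro subsetI, elim imageE)
    fix A k assume A: "A = {i. k i = 1}" and k: "k \<in> ?K"
    have "A \<noteq> UNIV"
    proof
      assume "A = UNIV"
      then have "k = (\<lambda>_. 1)" using A by auto
      then show False using k assms by (simp add: frequency_def)
    qed
    then show "A \<in> Pow UNIV - {UNIV}" by simp
  qed
  ultimately have "card ?K \<le> card (Pow (UNIV :: 'n set) - {UNIV})"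
    by (intro card_inj_on_le[where f = "\<lambda>k. {i. k i = 1}"]) auto
  also have "\<dots> < card (Pow (UNIV :: 'n set))"
    by (intro psubset_card_mono) auto
  finally show ?thesis by (simp add: card_Pow)
qed

lemma frequency_axis: "frequency ((\<lambda>_. 0)(i := 2)) = 4"
  unfolding frequency_def by (subst sum.remove[of _ i]) auto

text \<open>
  The indices \<open>j < \<kappa>(4)\<close> carry eigenvalues below 4, hence one of 0, 1, 2, 3, and each of these is listed
  as often as there are multi-indices of that frequency.
\<close>
lemma neumann_kappa_4_le:
  assumes "CARD('n::finite) \<ge> 4"
  shows "\<exists>m\<ge>1. neumann_eigenvalue (hypercube pi :: (real ^ 'n) set) m = 4"
    and "neumann_kappa (hypercube pi :: (real ^ 'n) set) 4 \<le> 2 ^ CARD('n)"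
proof -
  define \<Lambda> where "\<Lambda> = neumann_eigenvalue (hypercube pi :: (real ^ 'n) set)"
  define \<kappa> where "\<kappa> = neumann_kappa (hypercube pi :: (real ^ 'n) set) 4"
  define J where "J \<mu> = {j. 1 \<le> j \<and> \<Lambda> j = \<mu>}" for \<mu>
  have J: "finite (J \<mu>)" "card (J \<mu>) = card {k :: 'n \<Rightarrow> nat. real (frequency k) = \<mu>}" for \<mu>
    unfolding J_def \<Lambda>_def by (rule neumann_eigenvalue_multiplicity)+
  have "((\<lambda>_. 0)(undefined := 2)) \<in> {k :: 'n \<Rightarrow> nat. real (frequency k) = 4}"
    using frequency_axis by simp
  then have "card (J 4) \<noteq> 0"
    unfolding J(2) using finite_frequency_eq[where 'n = 'n and \<mu> = 4] by (auto simp: card_eq_0_iff)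
  then have ex: "\<exists>m\<ge>1. \<Lambda> m = 4"
    by (auto simp: J_def card_eq_0_iff)
  then show "\<exists>m\<ge>1. neumann_eigenvalue (hypercube pi :: (real ^ 'n) set) m = 4"
    by (simp add: \<Lambda>_def)
  have \<kappa>_eq: "\<kappa> = (LEAST k. 1 \<le> k \<and> \<Lambda> k = 4)"
    by (simp add: \<kappa>_def neumann_kappa_def \<Lambda>_def)
  have \<kappa>: "1 \<le> \<kappa>" "\<Lambda> \<kappa> = 4"
    unfolding \<kappa>_eq using LeastI_ex[OF ex[unfolded Bex_def]] by auto
  have "{1..<\<kappa>} \<subseteq> (\<Union>m\<in>{..<4::nat}. J (real m))"
  proof
    fix j assume j: "j \<in> {1..<\<kappa>}"
    have "mono_on {1..} \<Lambda>"
      using neumann_listing_eigenvalue[where 'n = 'n] by (simp add: neumann_listing_def \<Lambda>_def)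
    then have "\<Lambda> j \<le> \<Lambda> \<kappa>"
      using j by (intro mono_onD[of "{1..}" \<Lambda>]) auto
    moreover have "\<Lambda> j \<noteq> 4"
      using not_less_Least[of j "\<lambda>k. 1 \<le> k \<and> \<Lambda> k = 4"] j by (simp add: \<kappa>_eq)
    ultimately have less: "\<Lambda> j < 4" using \<kappa> by simp
    have "j \<in> J (\<Lambda> j)" using j by (simp add: J_def)
    then have "card (J (\<Lambda> j)) \<noteq> 0" using J(1) by auto
    then obtain k :: "'n \<Rightarrow> nat" where k: "real (frequency k) = \<Lambda> j"
      unfolding J(2) by (auto simp: card_eq_0_iff)
    with less have "frequency k < 4" by linarith
    with k j show "j \<in> (\<Union>m\<in>{..<4::nat}. J (real m))"
      by (auto simp: J_def intro!: bexI[of _ "frequency k"])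
  qed
  then have "card {1..<\<kappa>} \<le> card (\<Union>m\<in>{..<4::nat}. J (real m))"
    using J(1) by (intro card_mono) auto
  also have "\<dots> \<le> (\<Sum>m<4. card (J (real m)))"
    by (rule card_UN_le) simp
  also have "\<dots> = (\<Sum>m<4. card {k :: 'n \<Rightarrow> nat. frequency k = m})"
    by (simp add: J(2))
  also have "\<dots> = card (\<Union>m\<in>{..<4}. {k :: 'n \<Rightarrow> nat. frequency k = m})"
  proof (rule card_UN_disjoint[symmetric])
    show "\<forall>m\<in>{..<4}. finite {k :: 'n \<Rightarrow> nat. frequency k = m}"
      using finite_frequency_eq[where 'n = 'n and \<mu> = "real _"] by simp
  qed auto
  also have "(\<Union>m\<in>{..<4}. {k :: 'n \<Rightarrow> nat. frequency k = m}) = {k. frequency k < 4}"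
    by auto
  also have "card \<dots> < 2 ^ CARD('n)"
    using assms by (rule card_frequency_less_4)
  finally show "neumann_kappa (hypercube pi :: (real ^ 'n) set) 4 \<le> 2 ^ CARD('n)"
    using \<kappa>(1) by (simp add: \<kappa>_def)
qed

section \<open>A function with a nodal domain at every corner\<close>

text \<open>
  The constant \<open>n - 1\<close> lies between the value \<open>n\<close> of the sum at the corners and its upper bound
  \<open>n - 2\<close> on the hyperplanes through the centre. As a function on the whole space,
  \<open>corner_function\<close> is continuous up to the boundary, unlike the eigenfunctions extended by 0.
\<close>
definition corner_function :: "real ^ 'n::finite \<Rightarrow> real" where
  "corner_function x = (\<Sum>i\<in>UNIV. cos (2 * x $ i)) - (real CARD('n) - 1)"

definition corner_eigensum :: "real ^ 'n::finite \<Rightarrow> real" where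
  "corner_eigensum = (\<Sum>i\<in>UNIV. cosine_eigenfunction ((\<lambda>_. 0)(i := 2)))
     - (real CARD('n) - 1) *\<^sub>R cosine_eigenfunction (\<lambda>_. 0)"

lemma corner_eigensum_eq: "x \<in> hypercube pi \<Longrightarrow> corner_eigensum x = corner_function x"
proof -
  assume x: "x \<in> hypercube pi"
  have "cosine_product ((\<lambda>_. 0)(i := 2)) x = cos (2 * x $ i)" for i
    unfolding cosine_product_def tensor_def by (subst prod.remove[of _ i]) auto
  with x show ?thesis
    by (simp add: corner_eigensum_def corner_function_def sum_fun_apply scaleR_fun_def
        cosine_eigenfunction_def cosine_product_0)
qed

lemma cosine_eigenfunction_is_eigenfunction:
  "neumann_eigenfunction (hypercube pi) (real (frequency k)) (cosine_eigenfunction k)"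
proof -
  obtain x :: "real ^ 'a" where "x \<in> hypercube pi" "0 < cosine_product k x"
    using cosine_product_near_0 by blast
  then have "cosine_eigenfunction k \<noteq> 0"
    by (auto simp: cosine_eigenfunction_def fun_eq_iff intro!: exI[of _ x])
  then show ?thesis
    by (simp add: neumann_eigenfunction_def cosine_eigenfunction_in_eigenspace)
qed

lemma corner_eigensum_in_combinations:
  "corner_eigensum \<in> neumann_combinations (hypercube pi :: (real ^ 'n::finite) set) 4"
proof -
  have "cosine_eigenfunction k \<in> neumann_combinations (hypercube pi) 4"
    if "frequency k \<le> 4" for k :: "'n \<Rightarrow> nat"
    unfolding neumann_combinations_def
    using cosine_eigenfunction_is_eigenfunction[of k] that
    by (intro span_base CollectI exI[of _ "real (frequency k)"]) simp
  moreover have "frequency (\<lambda>_::'n. 0) \<le> 4" "frequency ((\<lambda>_::'n. 0)(i := 2)) \<le> 4" for i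
    using frequency_axis[of i] by (simp_all add: frequency_def)
  ultimately show ?thesis
    unfolding corner_eigensum_def neumann_combinations_def
    by (intro span_diff span_sum span_scale) auto
qed

lemma continuous_corner_function: "continuous_on A corner_function"
  unfolding corner_function_def by (intro continuous_intros)

text \<open>
  The zero set is relatively closed in the cube, so that taking its closure adds boundary points only.
\<close>
lemma hypercube_minus_nodal_set:
  "hypercube pi - nodal_set (hypercube pi) corner_eigensum = {x \<in> hypercube pi. corner_function x \<noteq> 0}"
proof -
  let ?Z = "{x \<in> hypercube pi. corner_eigensum x = 0}"
  have "closed {x. corner_function x = 0}"
    using continuous_closed_preimage_constant[of UNIV corner_function 0]
    by (simp add: continuous_corner_function)
  then have "closure ?Z \<subseteq> {x. corner_function x = 0}"
    by (intro closure_minimal) (auto simp: corner_eigensum_eq)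
  moreover have "?Z \<subseteq> closure ?Z" by (rule closure_subset)
  ultimately show ?thesis
    unfolding nodal_set_def by (auto simp: corner_eigensum_eq)
qed

lemma connected_corner_function_pos:
  fixes C :: "(real ^ 'n::finite) set"
  assumes C: "connected C" "\<And>x. x \<in> C \<Longrightarrow> corner_function x \<noteq> 0"
    and xy: "x \<in> C" "y \<in> C" "0 < corner_function x"
  shows "0 < corner_function y"
proof (rule ccontr)
  assume "\<not> 0 < corner_function y"
  moreover have "connected (corner_function ` C)"
    by (intro connected_continuous_image continuous_corner_function C)
  ultimately have "0 \<in> corner_function ` C"
    using connectedD_interval[of "corner_function ` C" "corner_function y" "corner_function x" 0] xy
    by (simp add: not_less less_imp_le)
  then obtain z where "z \<in> C" "corner_function z = 0" by (auto simp: image_iff)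
  then show False using C(2) by simp
qed

lemma corner_function_mid_face_neg:
  assumes "x $ i = pi / 2" shows "corner_function x < 0"
proof -
  have "(\<Sum>i\<in>UNIV. cos (2 * x $ i)) = - 1 + (\<Sum>j\<in>UNIV - {i}. cos (2 * x $ j))"
    by (subst sum.remove[of _ i]) (simp_all add: assms)
  also have "(\<Sum>j\<in>UNIV - {i}. cos (2 * x $ j)) \<le> (\<Sum>j\<in>UNIV - {i}. 1)"
    by (intro sum_mono) simp
  also have "\<dots> = real CARD('a) - 1"
    by (simp add: card_Diff_singleton of_nat_diff Suc_leI)
  finally show ?thesis by (simp add: corner_function_def)
qed

text \<open>
  On its way to the other side of the hyperplane \<open>x\<^sub>i = \<pi>/2\<close> the connected set would meet this
  hyperplane, where the function is negative.
\<close>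
lemma connected_corner_side:
  fixes C :: "(real ^ 'n::finite) set"
  assumes C: "connected C" "\<And>x. x \<in> C \<Longrightarrow> corner_function x \<noteq> 0"
    and xy: "x \<in> C" "y \<in> C" "0 < corner_function x" "x $ i < pi / 2"
  shows "y $ i < pi / 2"
proof (rule ccontr)
  assume "\<not> y $ i < pi / 2"
  then obtain z where z: "z \<in> C" "z $ i = pi / 2"
    using connected_ivt_component_cart[OF C(1) xy(1,2), of i "pi / 2"] xy(4) by auto
  then show False
    using connected_corner_function_pos[OF C xy(1) z(1) xy(3)] corner_function_mid_face_neg[OF z(2)]
    by simp
qed

text \<open>
  The distance \<open>1/n\<close> to the faces is small enough: with \<open>cos (2 d) \<ge> 1 - 2 d\<^sup>2\<close> the function there
  is at least \<open>1 - 2/n\<close>.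
\<close>
definition corner_point :: "'n set \<Rightarrow> real ^ 'n::finite" where
  "corner_point A = (\<chi> i. if i \<in> A then pi - 1 / real CARD('n) else 1 / real CARD('n))"

lemma corner_point_properties:
  assumes "CARD('n::finite) \<ge> 4"
  shows "corner_point A \<in> (hypercube pi :: (real ^ 'n) set)"
    and "0 < corner_function (corner_point A :: real ^ 'n)"
    and "(corner_point A :: real ^ 'n) $ i < pi / 2 \<longleftrightarrow> i \<notin> A"
proof -
  define d where "d = 1 / real CARD('n)"
  have d: "0 < d" "d \<le> 1 / 4" "d * real CARD('n) = 1"
    using assms by (auto simp: d_def field_simps)
  show "corner_point A \<in> (hypercube pi :: (real ^ 'n) set)"
    using d pi_gt3 by (auto simp: hypercube_def corner_point_def d_def[symmetric])
  show "(corner_point A :: real ^ 'n) $ i < pi / 2 \<longleftrightarrow> i \<notin> A"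
    using d pi_gt3 by (auto simp: corner_point_def d_def[symmetric])
  have "cos (2 * (corner_point A :: real ^ 'n) $ j) = cos (2 * d)" for j
  proof -
    have "cos (2 * (pi - d)) = cos (2 * pi - 2 * d)" by (simp add: algebra_simps)
    also have "\<dots> = cos (2 * d)" by (simp add: cos_diff)
    finally show ?thesis by (simp add: corner_point_def d_def)
  qed
  then have eq: "corner_function (corner_point A :: real ^ 'n) = real CARD('n) * cos (2 * d) - (real CARD('n) - 1)"
    by (simp add: corner_function_def)
  have "(sin d)\<^sup>2 \<le> d\<^sup>2"
    using abs_sin_x_le_abs_x[of d] by (simp add: abs_le_square_iff)
  then have "1 - 2 * d\<^sup>2 \<le> cos (2 * d)"
    by (simp add: cos_double_sin)
  then have "real CARD('n) * (1 - 2 * d\<^sup>2) \<le> real CARD('n) * cos (2 * d)"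
    by (intro mult_left_mono) auto
  moreover have "real CARD('n) * (1 - 2 * d\<^sup>2) = real CARD('n) - 2 * d"
    using d(3) by (simp add: power2_eq_square algebra_simps)
  ultimately show "0 < corner_function (corner_point A :: real ^ 'n)"
    using d(2) unfolding eq by linarith
qed

lemma nodal_count_corner_eigensum:
  assumes "CARD('n::finite) \<ge> 4"
  shows "enat (2 ^ CARD('n) + 1) \<le> nodal_count (hypercube pi) (corner_eigensum :: real ^ 'n \<Rightarrow> real)"
proof -
  define U where "U = {x \<in> hypercube pi. corner_function (x :: real ^ 'n) \<noteq> 0}"
  define D where "D A = connected_component_set U (corner_point A)" for A :: "'n set"
  define c :: "real ^ 'n" where "c = (\<chi> i. pi / 2)"
  define E where "E = connected_component_set U c"
  have c: "corner_function c < 0" "c \<in> U"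
  proof -
    show "corner_function c < 0"
      by (rule corner_function_mid_face_neg[of _ undefined]) (simp add: c_def)
    then show "c \<in> U" by (simp add: U_def hypercube_def c_def)
  qed
  have p: "corner_point A \<in> U" for A
    using corner_point_properties(1,2)[OF assms, of A] by (simp add: U_def)
  have D: "connected (D A)" "\<And>x. x \<in> D A \<Longrightarrow> corner_function x \<noteq> 0" "corner_point A \<in> D A" for A
    using p[of A] connected_component_subset[of U "corner_point A"]
    by (auto simp: D_def U_def connected_component_refl_eq)
  note pp = corner_point_properties[OF assms]
  have side: "i \<notin> B" if "corner_point B \<in> D A" "i \<notin> A" for A B i
  proof -
    have "(corner_point B :: real ^ 'n) $ i < pi / 2"
      by (rule connected_corner_side[of "D A" "corner_point A"]) (use D pp that in auto)
    then show ?thesis unfolding pp(3) .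
  qed
  have inj: "inj D"
  proof (rule injI)
    fix A B assume "D A = D B"
    then have "corner_point B \<in> D A" "corner_point A \<in> D B" using D(3) by auto
    then show "A = B" using side by blast
  qed
  have "E \<notin> range D"
  proof
    assume "E \<in> range D"
    then obtain A where "E = D A" by auto
    moreover have "c \<in> E" using c(2) by (simp add: E_def connected_component_refl_eq)
    ultimately have "0 < corner_function c"
      using connected_corner_function_pos[OF D(1,2) D(3) _ pp(2)] by auto
    with c(1) show False by simp
  qed
  then have card: "card (insert E (range D)) = 2 ^ CARD('n) + 1"
    using card_image[OF inj] by (simp add: card_UNIV_set)
  have "insert E (range D) \<subseteq> components U"
    using p c(2) by (auto simp: D_def E_def components_def)
  then have "finite (components U) \<Longrightarrow> 2 ^ CARD('n) + 1 \<le> card (components U)"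
    using card_mono[of "components U" "insert E (range D)"] card by simp
  then show ?thesis
    unfolding nodal_count_def hypercube_minus_nodal_set U_def[symmetric] by (simp add: Let_def)
qed

theorem proposition2p2:
  assumes "CARD('n::finite) \<ge> 4"
  shows "\<not> ECP_neumann (hypercube pi :: (real ^ 'n) set) \<and>
    (\<exists>m\<ge>1. \<exists>v \<in> neumann_combinations (hypercube pi :: (real ^ 'n) set)
                      (neumann_eigenvalue (hypercube pi :: (real ^ 'n) set) m).
       nodal_count (hypercube pi) v >
         enat (neumann_kappa (hypercube pi :: (real ^ 'n) set)
                 (neumann_eigenvalue (hypercube pi :: (real ^ 'n) set) m)))"
proof -
  let ?\<Omega> = "hypercube pi :: (real ^ 'n) set"
  obtain m where m: "1 \<le> m" "neumann_eigenvalue ?\<Omega> m = 4"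
    using neumann_kappa_4_le(1)[OF assms] by blast
  have "enat (neumann_kappa ?\<Omega> 4) < enat (2 ^ CARD('n) + 1)"
    using neumann_kappa_4_le(2)[OF assms] by simp
  also have "\<dots> \<le> nodal_count ?\<Omega> corner_eigensum"
    by (rule nodal_count_corner_eigensum[OF assms])
  finally have v: "enat (neumann_kappa ?\<Omega> (neumann_eigenvalue ?\<Omega> m)) < nodal_count ?\<Omega> corner_eigensum"
    by (simp add: m(2))
  have ex: "\<exists>m\<ge>1. \<exists>v \<in> neumann_combinations ?\<Omega> (neumann_eigenvalue ?\<Omega> m).
      nodal_count ?\<Omega> v > enat (neumann_kappa ?\<Omega> (neumann_eigenvalue ?\<Omega> m))"
    using m v corner_eigensum_in_combinations by (intro exI[of _ m] conjI bexI[of _ corner_eigensum]) auto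
  moreover have "\<not> ECP_neumann ?\<Omega>"
    unfolding ECP_neumann_def using ex by (meson not_le)
  ultimately show ?thesis by blast
qed

end
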